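(* Let $n$ be a positive integer, let $v_1,\dots,v_n$ be real numbers with $\sum_{i=1}^n v_i^2\le 1$, and let $S:=\sum_{i=1}^n v_i\epsilon_i$. Then $$P(|S|\le 1)\ \ge\ G\!\left(\tfrac14\right)=\frac12-\frac{1-\Phi(2)}{4\,(1-\Phi(\sqrt2))}=\frac12-\frac{\Phi(-2)}{4\,\Phi(-\sqrt2)}\approx 0.42768 .$$
   Context: $\epsilon_1,\dots,\epsilon_n$ are independent Rademacher random variables, i.e. each takes the values $+1$ and $-1$ with probability $\tfrac12$. $\Phi$ denotes the standard normal distribution function. For $c>0$, $G(c):=\frac12\left(1-\frac12\,\frac{1-\Phi(c^{-1/2})}{1-\Phi(\sqrt2)}\right)$. *)

theory Defs
  imports "HOL-Probability.Probability"
begin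

definition Phi :: "real \<Rightarrow> real" where
  "Phi x = measure (density lborel std_normal_density) {..x}"

definition G :: "real \<Rightarrow> real" where
  "G c = (1/2) * (1 - (1/2) * (1 - Phi (c powr (-1/2))) / (1 - Phi (sqrt 2)))"

definition rademacher :: "nat \<Rightarrow> (nat \<Rightarrow> real) pmf" where
  "rademacher n = pmf_of_set (PiE {1..n} (\<lambda>_. {-1, 1}))"

end

theory Submission
  imports Defs "HOL-Real_Asymp.Real_Asymp"
begin

text \<open>
  We show the slightly stronger bound 43/100, using second moments only. Order the weights as
  \<open>a \<ge> b \<ge> c \<ge> d \<ge> \<dots> \<ge> 0\<close>. Two devices are combined.

  Fixing the signs of the first few weights, \<open>P(|S| \<le> 1)\<close> becomes the mean of an explicit even step
  function of the sum \<open>Y\<close> of the remaining terms; any downward parabola below this step function gives a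
  lower bound, because the second moment of \<open>Y\<close> is known.

  If the remaining weights are at most \<open>\<alpha>\<close>, run the partial sums until they exceed \<open>1 - \<alpha>\<close> in absolute
  value. At that moment they are still at most \<open>1\<close>, the continuation is symmetric, and Chebyshev's inequality
  shows that the final sum lies in \<open>[-1, 1]\<close> with probability almost 1/2; the martingale
  \<open>X\<^sup>2 + (remaining variance)\<close> controls how much variance is left when stopping.

  If \<open>a + b \<le> 1\<close>, two to four signs are fixed, according to how many weights exceed 49/200. If \<open>a + b > 1\<close>, the
  step function may dip near the origin, and the cases depend on whether the next weight is large enough
  to fill the dip.

  On the Gaussian side, \<open>G(1/4) \<le> 43/100\<close> amounts to \<open>1 - \<Phi>(2) \<ge> 0.28 (1 - \<Phi>(\<surd>2))\<close>.
\<close>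

section \<open>Averages over random signs\<close>

text \<open>This is the expectation of g at x plus the randomly signed sum of the list. Writing it
  as iterated averaging turns conditioning on the first signs into unfolding, and statements about
  the walk into list inductions.\<close>

fun sign_mean :: "(real \<Rightarrow> real) \<Rightarrow> real \<Rightarrow> real list \<Rightarrow> real" where
  "sign_mean g x [] = g x"
| "sign_mean g x (v # vs) = (sign_mean g (x + v) vs + sign_mean g (x - v) vs) / 2"

abbreviation sum_sq :: "real list \<Rightarrow> real" where
  "sum_sq vs \<equiv> (\<Sum>v\<leftarrow>vs. v\<^sup>2)"

lemma sum_sq_nonneg: "0 \<le> sum_sq vs"
  by (induction vs) auto

lemma sign_mean_mono:
  assumes "\<And>u. g u \<le> h u"
  shows "sign_mean g x vs \<le> sign_mean h x vs"
proof (induction vs arbitrary: x)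
  case (Cons v vs)
  show ?case
    using Cons.IH[of "x + v"] Cons.IH[of "x - v"] by simp
qed (use assms in simp)

lemma sign_mean_add:
  "sign_mean (\<lambda>u. g u + h u) x vs = sign_mean g x vs + sign_mean h x vs"
  by (induction vs arbitrary: x) (simp_all add: field_simps)

lemma sign_mean_divide:
  "sign_mean (\<lambda>u. g u / c) x vs = sign_mean g x vs / c"
  by (induction vs arbitrary: x) (simp_all add: add_divide_distrib)

text \<open>The cross terms of +v and -v cancel, so every further sign adds exactly its variance to
  the second moment.\<close>

lemma sign_mean_parabola:
  "sign_mean (\<lambda>u. c - k * u\<^sup>2) x vs = c - k * (x\<^sup>2 + sum_sq vs)"
proof (induction vs arbitrary: x)
  case (Cons v vs)
  then show ?case
    by (simp only: sign_mean.simps) (simp add: field_simps power2_eq_square)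
qed simp

lemma sign_mean_shift:
  "sign_mean g (x + y) vs = sign_mean (\<lambda>u. g (x + u)) y vs"
proof (induction vs arbitrary: y)
  case (Cons v vs)
  show ?case
    using Cons.IH[of "y + v"] Cons.IH[of "y - v"] by (simp add: algebra_simps)
qed simp

lemma sign_mean_minus:
  "sign_mean g (- x) vs = sign_mean (\<lambda>u. g (- u)) x vs"
proof (induction vs arbitrary: x)
  case (Cons v vs)
  show ?case
    using Cons.IH[of "x - v"] Cons.IH[of "x + v"] by (simp add: add.commute minus_diff_commute)
qed simp

text \<open>A randomly signed sum has the same law as its negative, so each continuation can be
  averaged with its reflection in x.\<close>

lemma sign_mean_symmetrize:
  "sign_mean g x vs = sign_mean (\<lambda>t. (g (x + t) + g (x - t)) / 2) 0 vs"
  using sign_mean_shift[of g x 0 vs] sign_mean_minus[of "\<lambda>u. g (x + u)" 0 vs]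
  by (simp add: sign_mean_divide sign_mean_add)

lemma sign_mean_append:
  "sign_mean g x (vs @ ws) = sign_mean (\<lambda>u. sign_mean g u ws) x vs"
  by (induction vs arbitrary: x) simp_all

text \<open>Fubini for two independent blocks of signs; it makes the order of the weights
  immaterial.\<close>

lemma sign_mean_commute:
  "sign_mean (\<lambda>u. sign_mean g u ws) x vs = sign_mean (\<lambda>u. sign_mean g u vs) x ws"
proof (induction ws arbitrary: g x)
  case Nil
  show ?case by simp
next
  case (Cons w ws)
  have "sign_mean (\<lambda>u. sign_mean g u (w # ws)) x vs =
      (sign_mean (\<lambda>u. sign_mean g (w + u) ws) x vs + sign_mean (\<lambda>u. sign_mean g (- w + u) ws) x vs) / 2"
    by (simp add: sign_mean_divide sign_mean_add add.commute)
  also have "\<dots> = (sign_mean (\<lambda>u. sign_mean g u ws) (w + x) vs + sign_mean (\<lambda>u. sign_mean g u ws) (- w + x) vs) / 2"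
    by (simp only: sign_mean_shift[of "\<lambda>u. sign_mean g u ws"])
  also have "\<dots> = sign_mean (\<lambda>u. sign_mean g u vs) x (w # ws)"
    by (simp add: Cons.IH add.commute)
  finally show ?case .
qed

text \<open>The few signs of \<open>ws\<close> become the inner mean, an explicit step function of
  the sum u of all other terms. That function is what gets compared with a parabola.\<close>

lemma sign_mean_prefix:
  "sign_mean g x (ws @ vs) = sign_mean (\<lambda>u. sign_mean g u ws) x vs"
  by (simp add: sign_mean_append sign_mean_commute)

lemma sign_mean_insort: "sign_mean g x (insort_key f v vs) = sign_mean g x (v # vs)"
proof (induction vs arbitrary: x)
  case (Cons w vs)
  have "sign_mean g x (w # v # vs) = sign_mean g x (v # w # vs)"
    using sign_mean_commute[of "\<lambda>u. sign_mean g u vs" "[v]" x "[w]"] by simp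
  then show ?case
    by (simp add: Cons.IH)
qed simp

lemma sign_mean_sort: "sign_mean g x (sort_key f vs) = sign_mean g x vs"
  by (induction vs arbitrary: x) (simp_all add: sign_mean_insort)

lemma sign_mean_abs: "sign_mean g x (map abs vs) = sign_mean g x vs"
  by (induction vs arbitrary: x) (auto simp: abs_if)

section \<open>From uniformly distributed sign vectors to sign means\<close>

lemma sign_mean_PiE:
  "(\<Sum>\<epsilon>\<in>PiE {1..n} (\<lambda>_. {-1, 1}). g (x + (\<Sum>i=1..n. v i * \<epsilon> i)))
    = 2 ^ n * sign_mean g x (map v [1..<Suc n])"
proof (induction n arbitrary: x)
  case 0
  show ?case by simp
next
  case (Suc n)
  let ?P = "PiE {1..n} (\<lambda>_. {-1, 1::real})"
  have ins: "{1..Suc n} = insert (Suc n) {1..n}" by auto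
  have inj: "inj_on (\<lambda>(y, h). h(Suc n := y)) ({-1, 1::real} \<times> ?P)"
    using inj_combinator[of "Suc n" "{1..n}" "\<lambda>_. {-1, 1::real}"] by simp
  have "(\<Sum>\<epsilon>\<in>PiE {1..Suc n} (\<lambda>_. {-1, 1}). g (x + (\<Sum>i=1..Suc n. v i * \<epsilon> i)))
      = (\<Sum>(y, h)\<in>{-1, 1} \<times> ?P. g (x + (\<Sum>i=1..Suc n. v i * (h(Suc n := y)) i)))"
    unfolding ins PiE_insert_eq
    by (subst sum.reindex[OF inj]) (simp add: case_prod_unfold o_def)
  also have "\<dots> = (\<Sum>(y, h)\<in>{-1, 1} \<times> ?P. g ((x + v (Suc n) * y) + (\<Sum>i=1..n. v i * h i)))"
  proof (rule sum.cong[OF refl], clarify)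
    fix y h
    have "(\<Sum>i=1..n. v i * (h(Suc n := y)) i) = (\<Sum>i=1..n. v i * h i)"
      by (rule sum.cong) auto
    then show "g (x + (\<Sum>i=1..Suc n. v i * (h(Suc n := y)) i))
        = g ((x + v (Suc n) * y) + (\<Sum>i=1..n. v i * h i))"
      by (simp add: algebra_simps)
  qed
  also have "\<dots> = (\<Sum>y\<in>{-1, 1}. \<Sum>h\<in>?P. g ((x + v (Suc n) * y) + (\<Sum>i=1..n. v i * h i)))"
    by (rule sum.cartesian_product[symmetric])
  also have "\<dots> = (\<Sum>y\<in>{-1, 1}. 2 ^ n * sign_mean g (x + v (Suc n) * y) (map v [1..<Suc n]))"
    by (simp only: Suc.IH)
  also have "\<dots> = 2 ^ Suc n * sign_mean g x (v (Suc n) # map v [1..<Suc n])"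
    by (simp add: algebra_simps del: upt_Suc)
  \<comment> \<open>The induction on n splits off the last index, while \<open>sign_mean\<close>
    consumes the list from its head.\<close>
  also have "sign_mean g x (v (Suc n) # map v [1..<Suc n]) = sign_mean g x (map v [1..<Suc (Suc n)])"
    using sign_mean_prefix[of g x "map v [1..<Suc n]" "[v (Suc n)]"]
    by (simp add: sign_mean_append)
  finally show ?case .
qed

definition unit_ind :: "real \<Rightarrow> real" where
  "unit_ind x = (if \<bar>x\<bar> \<le> 1 then 1 else 0)"

lemma prob_rademacher_eq_sign_mean:
  "measure_pmf.prob (rademacher n) {\<epsilon>. \<bar>\<Sum>i=1..n. v i * \<epsilon> i\<bar> \<le> 1}
    = sign_mean unit_ind 0 (map v [1..<Suc n])"
proof -
  let ?P = "PiE {1..n} (\<lambda>_. {-1, 1::real})"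
  have fin: "finite ?P" by (intro finite_PiE) auto
  have ne: "?P \<noteq> {}" by (simp add: PiE_eq_empty_iff)
  have card: "real (card ?P) = 2 ^ n" by (subst card_PiE) (auto simp: numeral_2_eq_2)
  have "real (card (?P \<inter> {\<epsilon>. \<bar>\<Sum>i=1..n. v i * \<epsilon> i\<bar> \<le> 1}))
      = (\<Sum>\<epsilon>\<in>?P. unit_ind (0 + (\<Sum>i=1..n. v i * \<epsilon> i)))"
    using fin by (simp add: unit_ind_def sum.If_cases)
  also have "\<dots> = 2 ^ n * sign_mean unit_ind 0 (map v [1..<Suc n])"
    by (rule sign_mean_PiE)
  finally show ?thesis
    unfolding rademacher_def measure_pmf_of_set[OF ne fin] card by simp
qed

lemma sign_mean_unit_ind_minus: "sign_mean unit_ind (- x) vs = sign_mean unit_ind x vs"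
proof -
  have "(\<lambda>u. unit_ind (- u)) = unit_ind" by (auto simp: unit_ind_def)
  then show ?thesis by (simp add: sign_mean_minus)
qed

text \<open>Opposite sign patterns of the fixed weights shift u by r and by -r. Grouping them gives
  a function that is even in both arguments, so only |r| and |u| matter.\<close>

definition pair_ind :: "real \<Rightarrow> real \<Rightarrow> real" where
  "pair_ind r u = unit_ind (u + r) + unit_ind (u - r)"

lemma pair_ind_nonneg: "0 \<le> pair_ind r u"
  by (simp add: pair_ind_def unit_ind_def)

lemma pair_ind_minus: "pair_ind (- r) u = pair_ind r u" "pair_ind r (- u) = pair_ind r u"
  by (auto simp: pair_ind_def unit_ind_def abs_if)

lemma pair_ind_ge_1:
  assumes "\<bar>\<bar>u\<bar> - \<bar>r\<bar>\<bar> \<le> 1"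
  shows "1 \<le> pair_ind r u"
  using assms by (auto simp: pair_ind_def unit_ind_def abs_if split: if_splits)

lemma pair_ind_eq_2:
  assumes "\<bar>u\<bar> + \<bar>r\<bar> \<le> 1"
  shows "pair_ind r u = 2"
  using assms by (auto simp: pair_ind_def unit_ind_def abs_if split: if_splits)

lemma sign_mean_eq_pair_ind: "sign_mean unit_ind x vs = sign_mean (\<lambda>u. pair_ind x u / 2) 0 vs"
proof -
  have "(\<lambda>t. (unit_ind (x + t) + unit_ind (x - t)) / 2) = (\<lambda>u. pair_ind x u / 2)"
    by (simp add: pair_ind_def unit_ind_def add.commute abs_minus_commute)
  then show ?thesis
    using sign_mean_symmetrize[of unit_ind x vs] by simp
qed

text \<open>The sum over \<open>vs\<close> has second moment at most s, so the parabola C + k (s -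
  u^2) has mean at least C. Both sides are even in u, hence nonnegative u suffice.\<close>

lemma sign_mean_ge_of_parabola:
  assumes "\<And>u. 0 \<le> u \<Longrightarrow> C + k * (s - u\<^sup>2) \<le> sign_mean unit_ind u ws"
    and "0 \<le> k" "sum_sq vs \<le> s"
  shows "C \<le> sign_mean unit_ind 0 (ws @ vs)"
proof -
  have "C \<le> (C + k * s) - k * (0\<^sup>2 + sum_sq vs)"
    using mult_left_mono[OF assms(3,2)] by simp
  also have "\<dots> = sign_mean (\<lambda>u. (C + k * s) - k * u\<^sup>2) 0 vs"
    by (rule sign_mean_parabola[symmetric])
  also have "\<dots> \<le> sign_mean (\<lambda>u. sign_mean unit_ind u ws) 0 vs"
  proof (rule sign_mean_mono)
    fix u
    show "(C + k * s) - k * u\<^sup>2 \<le> sign_mean unit_ind u ws"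
      using assms(1)[of u] assms(1)[of "- u"] sign_mean_unit_ind_minus[of u ws]
      by (cases "0 \<le> u") (simp_all add: algebra_simps)
  qed
  also have "\<dots> = sign_mean unit_ind 0 (ws @ vs)"
    by (rule sign_mean_prefix[symmetric])
  finally show ?thesis .
qed

section \<open>Stopping\<close>

text \<open>Along the walk, x^2 plus the remaining variance is a martingale. A lower bound affine in
  it therefore passes back from the stopping time to the start: \<open>stop\<close> covers the first
  exit from [-\<xi>, \<xi>], which overshoots by at most c, and \<open>run\<close> a walk whose
  signs run out inside.\<close>

lemma sign_mean_stopping:
  assumes run: "\<And>x. \<bar>x\<bar> \<le> \<xi> \<Longrightarrow> A - B * x\<^sup>2 \<le> g x"
    and stop: "\<And>x ws. \<lbrakk>\<xi> < \<bar>x\<bar>; \<bar>x\<bar> \<le> \<xi> + c; sum_sq ws \<le> S\<rbrakk>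
      \<Longrightarrow> A - B * (x\<^sup>2 + sum_sq ws) \<le> sign_mean g x ws"
    and "\<bar>x\<bar> \<le> \<xi> + c" "\<And>v. v \<in> set vs \<Longrightarrow> \<bar>v\<bar> \<le> c" "sum_sq vs \<le> S"
  shows "A - B * (x\<^sup>2 + sum_sq vs) \<le> sign_mean g x vs"
  using assms(3-)
proof (induction vs arbitrary: x)
  case Nil
  then show ?case
    using run[of x] stop[of x "[]"] by (cases "\<bar>x\<bar> \<le> \<xi>") auto
next
  case (Cons v vs)
  show ?case
  proof (cases "\<bar>x\<bar> \<le> \<xi>")
    case True
    have "\<bar>v\<bar> \<le> c" using Cons.prems by simp
    with True have "\<bar>x + v\<bar> \<le> \<xi> + c" "\<bar>x - v\<bar> \<le> \<xi> + c" by linarith+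
    moreover have "sum_sq vs \<le> S"
      using Cons.prems(3) zero_le_power2[of v] unfolding list.map sum_list.Cons by linarith
    ultimately have "A - B * ((x + v)\<^sup>2 + sum_sq vs) \<le> sign_mean g (x + v) vs"
      "A - B * ((x - v)\<^sup>2 + sum_sq vs) \<le> sign_mean g (x - v) vs"
      using Cons.IH Cons.prems by simp_all
    moreover have "B * ((x + v)\<^sup>2 + sum_sq vs) + B * ((x - v)\<^sup>2 + sum_sq vs)
        = 2 * (B * (x\<^sup>2 + sum_sq (v # vs)))"
      by (simp add: algebra_simps power2_eq_square)
    ultimately show ?thesis by simp
  next
    case False
    with Cons.prems show ?thesis by (intro stop) simp_all
  qed
qed

text \<open>For a continuation t with |t| at most 1 + |x|, one of x + t and x - t lies in [-1, 1].
  Larger |t| is charged to the second moment; the condition on B makes the parabola nonpositive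
  there.\<close>

lemma sign_mean_ge_half:
  assumes "\<bar>x\<bar> \<le> 1" "1 \<le> 2 * B * (1 + \<bar>x\<bar>)\<^sup>2"
  shows "1 / 2 - B * sum_sq vs \<le> sign_mean unit_ind x vs"
proof -
  have "1 / 2 - B * sum_sq vs = sign_mean (\<lambda>u. 1 / 2 - B * u\<^sup>2) 0 vs"
    using sign_mean_parabola[of "1 / 2" B 0 vs] by simp
  also have "\<dots> \<le> sign_mean (\<lambda>u. pair_ind x u / 2) 0 vs"
  proof (rule sign_mean_mono)
    fix u
    have "0 < B * (1 + \<bar>x\<bar>)\<^sup>2" using assms(2) by simp
    then have "0 < B" by (simp add: zero_less_mult_iff)
    show "1 / 2 - B * u\<^sup>2 \<le> pair_ind x u / 2"
    proof (cases "\<bar>u\<bar> \<le> 1 + \<bar>x\<bar>")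
      case True
      then have "1 \<le> pair_ind x u" using assms(1) by (intro pair_ind_ge_1) simp
      moreover have "0 \<le> B * u\<^sup>2" using \<open>0 < B\<close> by simp
      ultimately show ?thesis by simp
    next
      case False
      then have "(1 + \<bar>x\<bar>)\<^sup>2 \<le> u\<^sup>2" by (intro iffD1[OF abs_le_square_iff]) simp
      then have "B * (1 + \<bar>x\<bar>)\<^sup>2 \<le> B * u\<^sup>2" using \<open>0 < B\<close> by simp
      then show ?thesis using assms(2) pair_ind_nonneg[of x u] by simp
    qed
  qed
  also have "\<dots> = sign_mean unit_ind x vs"
    by (rule sign_mean_eq_pair_ind[symmetric])
  finally show ?thesis .
qed

text \<open>Stop on leaving [-(1 - \<alpha>), 1 - \<alpha>]. The walk is then still in [-1, 1], and
  \<open>sign_mean_ge_half\<close> applies because 1 + |y| exceeds 2 - \<alpha>. The second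
  condition on B keeps the bound at most 1 for walks that never stop.\<close>

lemma sign_mean_ge_of_small_steps:
  assumes "\<bar>x\<bar> \<le> 1" "\<And>v. v \<in> set vs \<Longrightarrow> \<bar>v\<bar> \<le> \<alpha>" "0 \<le> \<alpha>" "\<alpha> \<le> 1"
    and B: "1 \<le> 2 * B * (2 - \<alpha>)\<^sup>2" "2 * B * (1 - \<alpha>)\<^sup>2 \<le> 1"
  shows "1 / 2 + B * ((1 - \<alpha>)\<^sup>2 - x\<^sup>2 - sum_sq vs) \<le> sign_mean unit_ind x vs"
proof -
  have "0 < B * (2 - \<alpha>)\<^sup>2" using B(1) by simp
  then have "0 < B" by (simp add: zero_less_mult_iff)
  have "1 / 2 + B * (1 - \<alpha>)\<^sup>2 - B * (x\<^sup>2 + sum_sq vs) \<le> sign_mean unit_ind x vs"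
  proof (rule sign_mean_stopping[where \<xi> = "1 - \<alpha>" and c = \<alpha> and S = "sum_sq vs"])
    fix y :: real
    assume y: "\<bar>y\<bar> \<le> 1 - \<alpha>"
    then have "unit_ind y = 1" using assms(3) by (simp add: unit_ind_def)
    moreover have "0 \<le> B * y\<^sup>2" using \<open>0 < B\<close> by simp
    ultimately show "1 / 2 + B * (1 - \<alpha>)\<^sup>2 - B * y\<^sup>2 \<le> unit_ind y" using B(2) by simp
  next
    fix y ws
    assume y: "1 - \<alpha> < \<bar>y\<bar>" "\<bar>y\<bar> \<le> 1 - \<alpha> + \<alpha>"
    have "(2 - \<alpha>)\<^sup>2 \<le> (1 + \<bar>y\<bar>)\<^sup>2" using y assms(4) by (intro power_mono) auto
    then have "2 * B * (2 - \<alpha>)\<^sup>2 \<le> 2 * B * (1 + \<bar>y\<bar>)\<^sup>2" using \<open>0 < B\<close> by simp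
    then have "1 / 2 - B * sum_sq ws \<le> sign_mean unit_ind y ws"
      using y B(1) by (intro sign_mean_ge_half) auto
    moreover have "(1 - \<alpha>)\<^sup>2 \<le> y\<^sup>2" using y assms(4) by (intro iffD1[OF abs_le_square_iff]) auto
    then have "B * (1 - \<alpha>)\<^sup>2 \<le> B * y\<^sup>2" using \<open>0 < B\<close> by simp
    ultimately show "1 / 2 + B * (1 - \<alpha>)\<^sup>2 - B * (y\<^sup>2 + sum_sq ws) \<le> sign_mean unit_ind y ws"
      by (simp add: algebra_simps)
  qed (use assms in auto)
  then show ?thesis by (simp add: algebra_simps)
qed

section \<open>Parabolas below step functions\<close>

lemma pair_ind_ge_1_of_nonneg:
  "\<lbrakk>0 \<le> u; 0 \<le> r; r - 1 \<le> u; u \<le> 1 + r\<rbrakk> \<Longrightarrow> 1 \<le> pair_ind r u"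
  by (intro pair_ind_ge_1) simp

lemma pair_ind_ge_2:
  "\<lbrakk>0 \<le> u; 0 \<le> r; u \<le> 1 - r\<rbrakk> \<Longrightarrow> 2 \<le> pair_ind r u"
  using pair_ind_eq_2[of u r] by simp

lemma pair_ind_abs: "pair_ind r u = pair_ind \<bar>r\<bar> u"
  by (simp add: abs_if pair_ind_minus)

lemma sign_mean_1: "sign_mean unit_ind u [a] = pair_ind a u / 2"
  by (simp add: pair_ind_def)

lemma sign_mean_2: "sign_mean unit_ind u [a, b] = (pair_ind (a + b) u + pair_ind (a - b) u) / 4"
  by (simp add: pair_ind_def add_divide_distrib algebra_simps)

lemma sign_mean_3:
  "sign_mean unit_ind u [a, b, c] =
    (pair_ind (a + b + c) u + pair_ind (a + b - c) u + pair_ind (a - b + c) u + pair_ind \<bar>b + c - a\<bar> u) / 8"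
  unfolding pair_ind_abs[symmetric] by (simp add: pair_ind_def add_divide_distrib algebra_simps)

lemma sign_mean_4:
  "sign_mean unit_ind u [a, b, c, d] =
    (pair_ind (a + b + c + d) u + pair_ind (a + b + c - d) u + pair_ind (a + b - c + d) u
      + pair_ind (a - b + c + d) u + pair_ind (- a + b + c + d) u
      + pair_ind (a + b - c - d) u + pair_ind (a - b + c - d) u + pair_ind \<bar>a + d - b - c\<bar> u) / 16"
  unfolding pair_ind_abs[symmetric] by (simp add: pair_ind_def add_divide_distrib algebra_simps)

lemma sum_two_squares_ge: "(x + y)\<^sup>2 \<le> 2 * (x\<^sup>2 + y\<^sup>2)" for x y :: real
  using zero_le_power2[of "x - y"] by (simp add: power2_eq_square algebra_simps)

lemma sum_three_squares_ge: "(x + y + z)\<^sup>2 \<le> 3 * (x\<^sup>2 + y\<^sup>2 + z\<^sup>2)" for x y z :: real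
  using zero_le_power2[of "x - y"] zero_le_power2[of "x - z"] zero_le_power2[of "y - z"]
  by (simp add: power2_eq_square algebra_simps)

section \<open>Cases settled by one parabola after fixing one to four signs\<close>

lemma sign_mean_ge_one_big:
  assumes "72 / 100 \<le> a" "sum_sq (a # vs) \<le> 1"
  shows "43 / 100 \<le> sign_mean unit_ind 0 (a # vs)"
proof -
  have "a\<^sup>2 \<le> 1"
    using assms(2) sum_sq_nonneg[of vs] by simp
  then have "a \<le> 1"
    using abs_le_square_iff[of a 1] by simp
  have "43 / 100 \<le> sign_mean unit_ind 0 ([a] @ vs)"
  \<comment> \<open>This k makes the parabola drop by exactly 1/2 from u = 1 - a to u = 1 + a, the
    height of one jump. Both breakpoints then give the same condition, a at least 72/100.\<close>
  proof (rule sign_mean_ge_of_parabola[where k = "1 / (8 * a)" and s = "1 - a\<^sup>2"])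
    fix u :: real
    assume u: "0 \<le> u"
    show "43 / 100 + 1 / (8 * a) * (1 - a\<^sup>2 - u\<^sup>2) \<le> sign_mean unit_ind u [a]"
    proof -
      have *: "43 / 100 + 1 / (8 * a) * (1 - a\<^sup>2 - u\<^sup>2) \<le> C"
        if "x \<le> u" "0 \<le> x" "1 - a\<^sup>2 - x\<^sup>2 \<le> 8 * a * (C - 43 / 100)" for x C
      proof -
        have "x\<^sup>2 \<le> u\<^sup>2" using that by (intro power_mono) auto
        then have "1 - a\<^sup>2 - u\<^sup>2 \<le> 8 * a * (C - 43 / 100)" using that by linarith
        then show ?thesis using assms(1) by (simp add: field_simps)
      qed
      consider "u \<le> 1 - a" | "1 - a < u" "u \<le> 1 + a" | "1 + a < u" by linarith
      then show ?thesis
      proof cases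
        case 1
        then have "2 \<le> pair_ind a u" using u assms(1) by (intro pair_ind_ge_2) auto
        moreover have "1 - a\<^sup>2 \<le> 8 * a * (57 / 100)" using assms(1) zero_le_power2[of a] by linarith
        ultimately show ?thesis
          using u unfolding sign_mean_1 by (intro order_trans[OF *[of 0 1]]) simp_all
      next
        case 2
        then have "1 \<le> pair_ind a u" using u \<open>a \<le> 1\<close> assms(1) by (intro pair_ind_ge_1_of_nonneg) auto
        moreover have "1 - a\<^sup>2 - (1 - a)\<^sup>2 \<le> 8 * a * (1 / 2 - 43 / 100)"
          using mult_left_mono[of "72 / 100" a a] assms(1) by (simp add: power2_eq_square algebra_simps)
        ultimately show ?thesis
          using 2 \<open>a \<le> 1\<close> unfolding sign_mean_1 by (intro order_trans[OF *[of "1 - a" "1 / 2"]]) linarith+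
      next
        case 3
        have "1 - a\<^sup>2 - (1 + a)\<^sup>2 \<le> 8 * a * (0 - 43 / 100)"
          using mult_left_mono[of "72 / 100" a a] assms(1) by (simp add: power2_eq_square algebra_simps)
        then show ?thesis
          using 3 assms(1) pair_ind_nonneg[of a u] unfolding sign_mean_1
          by (intro order_trans[OF *[of "1 + a" 0]]) linarith+
      qed
    qed
  qed (use assms in auto)
  then show ?thesis by simp
qed

text \<open>The parabola is placed below the levels 1/2, 1/4 and 0, which start at 0, 1 + a - b and
  1 + a + b; the three conditions on k say just this.\<close>

lemma sign_mean_ge_two_big:
  assumes ab: "b \<le> a" "a \<le> 1" "1 \<le> a + b"
    and k: "k * (1 - a\<^sup>2 - b\<^sup>2) \<le> 7 / 100" "1 / 4 \<le> k * (1 + a - b)\<^sup>2" "1 / 2 \<le> k * (1 + a + b)\<^sup>2"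
    and "sum_sq (a # b # vs) \<le> 1"
  shows "43 / 100 \<le> sign_mean unit_ind 0 (a # b # vs)"
proof -
  have "0 < k * (1 + a - b)\<^sup>2" using k by simp
  then have "0 < k" by (simp add: zero_less_mult_iff)
  have "43 / 100 \<le> sign_mean unit_ind 0 ([a, b] @ vs)"
  proof (rule sign_mean_ge_of_parabola[where k = k and s = "1 - a\<^sup>2 - b\<^sup>2"])
    fix u :: real
    assume u: "0 \<le> u"
    have *: "k * x\<^sup>2 \<le> k * u\<^sup>2" if "x \<le> u" "0 \<le> x" for x
      using that \<open>0 < k\<close> by (simp add: power_mono)
    have n: "0 \<le> pair_ind (a + b) u" "0 \<le> pair_ind (a - b) u" by (rule pair_ind_nonneg)+
    consider "u \<le> 1 - (a - b)" | "1 - (a - b) < u" "u \<le> 1 + (a - b)"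
      | "1 + (a - b) < u" "u \<le> 1 + (a + b)" | "1 + (a + b) < u" by linarith
    then show "43 / 100 + k * (1 - a\<^sup>2 - b\<^sup>2 - u\<^sup>2) \<le> sign_mean unit_ind u [a, b]"
      unfolding sign_mean_2 right_diff_distrib[of k "1 - a\<^sup>2 - b\<^sup>2"]
    proof cases
      case 1
      then have "2 \<le> pair_ind (a - b) u" using u ab by (intro pair_ind_ge_2) auto
      then show "43 / 100 + (k * (1 - a\<^sup>2 - b\<^sup>2) - k * u\<^sup>2) \<le> (pair_ind (a + b) u + pair_ind (a - b) u) / 4"
        using *[of 0] k u n by simp
    next
      case 2
      then have "1 \<le> pair_ind (a - b) u" "1 \<le> pair_ind (a + b) u"
        using u ab by (auto intro!: pair_ind_ge_1_of_nonneg)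
      then show "43 / 100 + (k * (1 - a\<^sup>2 - b\<^sup>2) - k * u\<^sup>2) \<le> (pair_ind (a + b) u + pair_ind (a - b) u) / 4"
        using *[of 0] k u n by simp
    next
      case 3
      then have "1 \<le> pair_ind (a + b) u"
        using u ab by (auto intro!: pair_ind_ge_1_of_nonneg)
      then show "43 / 100 + (k * (1 - a\<^sup>2 - b\<^sup>2) - k * u\<^sup>2) \<le> (pair_ind (a + b) u + pair_ind (a - b) u) / 4"
        using *[of "1 + a - b"] 3 k u n ab by simp
    next
      case 4
      then show "43 / 100 + (k * (1 - a\<^sup>2 - b\<^sup>2) - k * u\<^sup>2) \<le> (pair_ind (a + b) u + pair_ind (a - b) u) / 4"
        using *[of "1 + a + b"] 4 k u n ab by simp
    qed
  qed (use assms \<open>0 < k\<close> in auto)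
  then show ?thesis by simp
qed

text \<open>A shift r in [0, 1] contributes 2 for u up to 1 - r and at least 1 up to 1 + r. By a + b
  - c \<le> 1 only the shift a + b + c can exceed 1, and it is counted only from u = a + b + c - 1
  on.\<close>

lemma sign_mean_3_ge:
  assumes "0 \<le> c" "c \<le> b" "b \<le> a" "a + b - c \<le> 1" "0 \<le> u"
  shows "u \<le> 1 - (a - b + c) \<Longrightarrow> 5 / 8 \<le> sign_mean unit_ind u [a, b, c]"
    and "a + b \<le> 1 \<Longrightarrow> u \<le> 1 - (a - b + c) \<Longrightarrow> 6 / 8 \<le> sign_mean unit_ind u [a, b, c]"
    and "u \<le> 1 - \<bar>b + c - a\<bar> \<Longrightarrow> 4 / 8 \<le> sign_mean unit_ind u [a, b, c]"
    and "\<lbrakk>u \<le> 1 - \<bar>b + c - a\<bar>; a + b + c - 1 \<le> u\<rbrakk> \<Longrightarrow> 5 / 8 \<le> sign_mean unit_ind u [a, b, c]"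
    and "\<lbrakk>u \<le> 1 + \<bar>b + c - a\<bar>; a + b + c - 1 \<le> u\<rbrakk> \<Longrightarrow> 4 / 8 \<le> sign_mean unit_ind u [a, b, c]"
    and "\<lbrakk>u \<le> 1 + (a - b + c); a + b + c - 1 \<le> u\<rbrakk> \<Longrightarrow> 3 / 8 \<le> sign_mean unit_ind u [a, b, c]"
    and "\<lbrakk>u \<le> 1 + (a + b - c); a + b + c - 1 \<le> u\<rbrakk> \<Longrightarrow> 2 / 8 \<le> sign_mean unit_ind u [a, b, c]"
    and "\<lbrakk>u \<le> 1 + (a + b + c); a + b + c - 1 \<le> u\<rbrakk> \<Longrightarrow> 1 / 8 \<le> sign_mean unit_ind u [a, b, c]"
    and "0 \<le> sign_mean unit_ind u [a, b, c]"
proof -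
  define r0 r1 r2 r3 where r: "r0 = a + b + c" "r1 = a + b - c" "r2 = a - b + c" "r3 = \<bar>b + c - a\<bar>"
  have le: "0 \<le> r3" "r3 \<le> r2" "r2 \<le> r1" "r1 \<le> r0" "r1 \<le> 1"
    using assms unfolding r by linarith+
  have eq: "sign_mean unit_ind u [a, b, c] = (pair_ind r0 u + pair_ind r1 u + pair_ind r2 u + pair_ind r3 u) / 8"
    unfolding r by (rule sign_mean_3)
  have p0: "0 \<le> pair_ind r0 u" "0 \<le> pair_ind r1 u" "0 \<le> pair_ind r2 u" "0 \<le> pair_ind r3 u"
    by (rule pair_ind_nonneg)+
  have p1: "1 \<le> pair_ind r u" if "r \<in> {r0, r1, r2, r3}" "u \<le> 1 + r" "r - 1 \<le> u" for r
    using that le assms(5) by (intro pair_ind_ge_1_of_nonneg) auto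
  have p2: "2 \<le> pair_ind r u" if "r \<in> {r0, r1, r2, r3}" "u \<le> 1 - r" for r
    using that le assms(5) by (intro pair_ind_ge_2) auto
  have one: "1 \<le> pair_ind r1 u" if "u \<le> 1 + r1"
    using that le assms(5) by (intro p1) auto
  have two: "1 \<le> pair_ind r2 u" if "u \<le> 1 + r2"
    using that le assms(5) by (intro p1) auto
  have three: "1 \<le> pair_ind r3 u" if "u \<le> 1 + r3"
    using that le assms(5) by (intro p1) auto
  have zero: "1 \<le> pair_ind r0 u" if "u \<le> 1 + r0" "r0 - 1 \<le> u"
    using that le assms(5) by (intro p1) auto
  have two': "2 \<le> pair_ind r2 u" if "u \<le> 1 - r2"
    using that by (intro p2) auto
  have three': "2 \<le> pair_ind r3 u" if "u \<le> 1 - r3"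
    using that by (intro p2) auto
  show "5 / 8 \<le> sign_mean unit_ind u [a, b, c]" if "u \<le> 1 - (a - b + c)"
    using one two' three' p0 le that assms(5) unfolding eq r(3)[symmetric] by argo
  show "6 / 8 \<le> sign_mean unit_ind u [a, b, c]" if "a + b \<le> 1" "u \<le> 1 - (a - b + c)"
  proof (cases "u \<le> 1 - r1")
    case True
    then have "2 \<le> pair_ind r1 u" by (intro p2) auto
    then show ?thesis
      using two' three' p0 le that assms(5) unfolding eq r(3)[symmetric] by argo
  next
    case False
    \<comment> \<open>Here r0 + r1 = 2 (a + b) is at most 2, so r0 starts to contribute no later
      than r1 loses its second hit.\<close>
    then have "r0 - 1 \<le> u" using that(1) unfolding r by linarith
    then show ?thesis
      using zero one two' three' p0 le that assms(5) unfolding eq r(3)[symmetric] by argo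
  qed
  show "4 / 8 \<le> sign_mean unit_ind u [a, b, c]" if "u \<le> 1 - \<bar>b + c - a\<bar>"
    using one two three' p0 le that assms(5) unfolding eq r(4)[symmetric] by argo
  show "5 / 8 \<le> sign_mean unit_ind u [a, b, c]" if "u \<le> 1 - \<bar>b + c - a\<bar>" "a + b + c - 1 \<le> u"
    using zero one two three' p0 le that assms(5) unfolding eq r(1,4)[symmetric] by argo
  show "4 / 8 \<le> sign_mean unit_ind u [a, b, c]" if "u \<le> 1 + \<bar>b + c - a\<bar>" "a + b + c - 1 \<le> u"
    using zero one two three p0 le that assms(5) unfolding eq r(1,4)[symmetric] by argo
  show "3 / 8 \<le> sign_mean unit_ind u [a, b, c]" if "u \<le> 1 + (a - b + c)" "a + b + c - 1 \<le> u"
    using zero one two p0 le that assms(5) unfolding eq r(1,3)[symmetric] by argo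
  show "2 / 8 \<le> sign_mean unit_ind u [a, b, c]" if "u \<le> 1 + (a + b - c)" "a + b + c - 1 \<le> u"
    using zero one p0 le that assms(5) unfolding eq r(1,2)[symmetric] by argo
  show "1 / 8 \<le> sign_mean unit_ind u [a, b, c]" if "u \<le> 1 + (a + b + c)" "a + b + c - 1 \<le> u"
    using zero p0 le that assms(5) unfolding eq r(1)[symmetric] by argo
  show "0 \<le> sign_mean unit_ind u [a, b, c]"
    using p0 unfolding eq by argo
qed

lemma sum_three_le_2:
  fixes a b c :: real
  assumes "a\<^sup>2 + b\<^sup>2 + c\<^sup>2 \<le> 1"
  shows "a + b + c \<le> 2"
proof -
  have "(a + b + c)\<^sup>2 \<le> 2\<^sup>2" using sum_three_squares_ge[of a b c] assms by simp
  then show ?thesis by (rule power2_le_imp_le) simp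
qed

lemma square_ge: "0 \<le> x \<Longrightarrow> x \<le> u \<Longrightarrow> x * x \<le> u\<^sup>2" for x u :: real
  by (simp add: power2_eq_square mult_mono)

lemma sign_mean_ge_three_of_pair_le_1:
  assumes abc: "49 / 200 \<le> c" "c \<le> b" "b \<le> a" "a + b \<le> 1" "1 \<le> a + b + c"
    and sum: "sum_sq (a # b # c # vs) \<le> 1"
  shows "43 / 100 \<le> sign_mean unit_ind 0 (a # b # c # vs)"
proof -
  let ?Q = "a\<^sup>2 + b\<^sup>2 + c\<^sup>2"
  have Q: "?Q \<le> 1" using sum sum_sq_nonneg[of vs] by simp
  have "1 \<le> (a + b + c)\<^sup>2" using abc(5) by (simp add: one_le_power)
  then have Q3: "1 / 3 \<le> ?Q" using sum_three_squares_ge[of a b c] by argo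
  have "43 / 100 \<le> sign_mean unit_ind 0 ([a, b, c] @ vs)"
  proof (rule sign_mean_ge_of_parabola[where k = "28 / 100" and s = "1 - ?Q"])
    fix u :: real
    assume u: "0 \<le> u"
    have base: "0 \<le> c" "a + b - c \<le> 1" using abc by linarith+
    note ge = sign_mean_3_ge[OF base(1) abc(2,3) base(2) u]
    have r0: "a + b + c - 1 \<le> u" if "1 \<le> u" using sum_three_le_2[OF Q] that by linarith
    consider "u \<le> 1 - (a - b + c)" | "1 - (a - b + c) < u" "u \<le> 1 - \<bar>b + c - a\<bar>"
      | "1 - \<bar>b + c - a\<bar> < u" "u \<le> 1 + \<bar>b + c - a\<bar>" | "1 + \<bar>b + c - a\<bar> < u" "u \<le> 1 + (a - b + c)"
      | "1 + (a - b + c) < u" "u \<le> 1 + (a + b - c)" | "1 + (a + b - c) < u" "u \<le> 1 + (a + b + c)"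
      | "1 + (a + b + c) < u" by linarith
    then show "43 / 100 + 28 / 100 * (1 - ?Q - u\<^sup>2) \<le> sign_mean unit_ind u [a, b, c]"
    proof cases
      case 1
      then show ?thesis using ge(2)[OF abc(4)] Q3 zero_le_power2[of u] by argo
    next
      case 2
      have "a + b + c - 1 \<le> u" using 2 abc by linarith
      then show ?thesis using ge(4) 2 Q3 zero_le_power2[of u] by argo
    next
      case 3
      have "a + b + c - 1 \<le> u" using 3 abc by linarith
      \<comment> \<open>With k = 28/100 the level 4/8 is met exactly when Q + u^2 is at least 3/4,
        since 43/100 + 28/100 * 1/4 = 1/2.\<close>
      moreover have "3 / 4 \<le> ?Q + u\<^sup>2"
      proof (cases "a \<le> b + c")
        case True
        have "(1 - c) * (1 - c) \<le> u\<^sup>2" using True 3 abc by (intro square_ge) linarith+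
        moreover have "c\<^sup>2 \<le> b\<^sup>2" "c\<^sup>2 \<le> a\<^sup>2" using abc by (auto intro!: power_mono)
        moreover have "(1 - c) * (1 - c) + 3 * c\<^sup>2 = 3 / 4 + (2 * c - 1 / 2)\<^sup>2"
          by (simp add: power2_eq_square algebra_simps)
        ultimately show ?thesis using zero_le_power2[of "2 * c - 1 / 2"] by linarith
      next
        case False
        have "(1 - a + b + c)\<^sup>2 \<le> u\<^sup>2" using False 3 abc by (intro power_mono) linarith+
        moreover have "(149 / 100) * (149 / 100) \<le> (1 + b + c)\<^sup>2" using abc by (intro square_ge) linarith+
        moreover have "(1 + b + c)\<^sup>2 \<le> 2 * ((1 - a + b + c)\<^sup>2 + a\<^sup>2)"
          using sum_two_squares_ge[of "1 - a + b + c" a] by (simp add: algebra_simps)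
        ultimately show ?thesis using zero_le_power2[of b] zero_le_power2[of c] by argo
      qed
      ultimately show ?thesis using ge(5) 3 by argo
    next
      case 4
      then have "1 * 1 \<le> u\<^sup>2" by (intro square_ge) auto
      then show ?thesis using ge(6) r0 4 Q3 by argo
    next
      case 5
      then have "(6 / 5) * (6 / 5) \<le> u\<^sup>2" using abc by (intro square_ge) linarith+
      then show ?thesis using ge(7) r0 5 Q3 abc by argo
    next
      case 6
      then have "(4 / 3) * (4 / 3) \<le> u\<^sup>2" using abc by (intro square_ge) linarith+
      then show ?thesis using ge(8) r0 6 Q3 abc by argo
    next
      case 7
      then have "2 * 2 \<le> u\<^sup>2" using abc by (intro square_ge) linarith+
      then show ?thesis using ge(9) Q3 by argo
    qed
  qed (use sum in auto)
  then show ?thesis by simp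
qed

text \<open>The weight c fills the dip of the two-sign step function near 0, because a + b - c \<le>
  1. With Q at least 1/2, level 5/8 at the origin allows k up to 39/100, and level 2/8 from u = 1 on
  needs at least 36/100; 3/8 lies between.\<close>

lemma sign_mean_ge_three_of_pair_ge_1:
  assumes abc: "0 \<le> c" "c \<le> b" "b \<le> a" "1 \<le> a + b" "a + b - c \<le> 1" "a + c \<le> 1" "a - b \<le> 1 / 2"
    and sum: "a\<^sup>2 + b\<^sup>2 + c\<^sup>2 + sum_sq vs \<le> 1"
  shows "43 / 100 \<le> sign_mean unit_ind 0 (a # b # c # vs)"
proof -
  let ?Q = "a\<^sup>2 + b\<^sup>2 + c\<^sup>2"
  have Q: "?Q \<le> 1" using sum sum_sq_nonneg[of vs] by linarith
  have "1 \<le> (a + b)\<^sup>2" using abc(4) by (simp add: one_le_power)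
  moreover have "2 * (a\<^sup>2 + b\<^sup>2) = (a + b)\<^sup>2 + (a - b)\<^sup>2" by (simp add: power2_eq_square algebra_simps)
  ultimately have Q2: "1 / 2 + (a - b)\<^sup>2 / 2 + c\<^sup>2 \<le> ?Q" by argo
  have Q2': "1 / 2 + c\<^sup>2 \<le> ?Q" "1 / 2 \<le> ?Q"
    using Q2 zero_le_power2[of "a - b"] zero_le_power2[of c] by linarith+
  have "43 / 100 \<le> sign_mean unit_ind 0 ([a, b, c] @ vs)"
  proof (rule sign_mean_ge_of_parabola[where k = "3 / 8" and s = "1 - ?Q"])
    fix u :: real
    assume u: "0 \<le> u"
    note ge = sign_mean_3_ge[OF abc(1,2,3,5) u]
    have r0: "a + b + c - 1 \<le> u" if "1 - (a - b + c) < u" using abc that by linarith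
    consider "u \<le> 1 - (a - b + c)" | "1 - (a - b + c) < u" "u \<le> 1 - \<bar>b + c - a\<bar>"
      | "1 - \<bar>b + c - a\<bar> < u" "u \<le> 1 + \<bar>b + c - a\<bar>" | "1 + \<bar>b + c - a\<bar> < u" "u \<le> 1 + (a - b + c)"
      | "1 + (a - b + c) < u" "u \<le> 1 + (a + b - c)" | "1 + (a + b - c) < u" "u \<le> 1 + (a + b + c)"
      | "1 + (a + b + c) < u" by linarith
    then show "43 / 100 + 3 / 8 * (1 - ?Q - u\<^sup>2) \<le> sign_mean unit_ind u [a, b, c]"
    proof cases
      case 1
      then show ?thesis using ge(1) Q2' zero_le_power2[of u] by argo
    next
      case 2
      then show ?thesis using ge(4) r0 Q2' zero_le_power2[of u] by argo
    next
      case 3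
      have "1 - ?Q - u\<^sup>2 \<le> 1 / 8"
      proof (cases "a \<le> b + c")
        case True
        have "(1 - c) * (1 - c) \<le> u\<^sup>2" using True 3 abc by (intro square_ge) linarith+
        moreover have "c\<^sup>2 + (1 - c) * (1 - c) = 1 / 2 + 2 * (c - 1 / 2)\<^sup>2"
          by (simp add: power2_eq_square algebra_simps)
        ultimately show ?thesis using Q2' zero_le_power2[of "c - 1 / 2"] by linarith
      next
        case False
        define q where "q = a - b"
        have "(1 - q) * (1 - q) \<le> u\<^sup>2" using False 3 abc unfolding q_def by (intro square_ge) linarith+
        \<comment> \<open>The product is 8 times the excess of 1/2 + q^2/2 + (1 - q)^2 over 7/8, the
          value required in this case.\<close>
        moreover have "0 \<le> (1 - 2 * q) * (5 - 6 * q)"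
          using abc(7) unfolding q_def by (intro mult_nonneg_nonneg) auto
        moreover have "(1 - 2 * q) * (5 - 6 * q) = 4 * q\<^sup>2 + 8 * ((1 - q) * (1 - q)) - 3"
          by (simp add: power2_eq_square algebra_simps)
        ultimately show ?thesis using Q2 zero_le_power2[of c] False abc unfolding q_def[symmetric] by linarith
      qed
      then show ?thesis using ge(5) r0 3 abc by argo
    next
      case 4
      then have "1 * 1 \<le> u\<^sup>2" by (intro square_ge) auto
      then show ?thesis using ge(6) r0 4 Q2' abc by argo
    next
      case 5
      then have "1 * 1 \<le> u\<^sup>2" using abc by (intro square_ge) linarith+
      then show ?thesis using ge(7) r0 5 Q2' abc by argo
    next
      case 6
      then have "(3 / 2) * (3 / 2) \<le> u\<^sup>2" using abc by (intro square_ge) linarith+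
      then show ?thesis using ge(8) r0 6 Q2' abc by argo
    next
      case 7
      then have "2 * 2 \<le> u\<^sup>2" using abc by (intro square_ge) linarith+
      then show ?thesis using ge(9) Q2' by argo
    qed
  qed (use sum in auto)
  then show ?thesis by simp
qed

lemma sign_mean_ge_three_of_two_pairs_ge_1:
  assumes abc: "7 / 25 \<le> c" "c \<le> b" "b \<le> a" "a \<le> 1" "1 \<le> a + c" "a + b - c \<le> 1" "b + c \<le> 1"
    and sum: "a\<^sup>2 + b\<^sup>2 + c\<^sup>2 + sum_sq vs \<le> 1"
  shows "43 / 100 \<le> sign_mean unit_ind 0 (a # b # c # vs)"
proof -
  let ?Q = "a\<^sup>2 + b\<^sup>2 + c\<^sup>2"
  have Q: "?Q \<le> 1" using sum sum_sq_nonneg[of vs] by linarith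
  have "(1 - a)\<^sup>2 \<le> b\<^sup>2" "(1 - a)\<^sup>2 \<le> c\<^sup>2" using abc by (auto intro!: power_mono)
  moreover have "a\<^sup>2 + 2 * (1 - a)\<^sup>2 = 2 / 3 + 3 * (a - 2 / 3)\<^sup>2"
    by (simp add: power2_eq_square algebra_simps)
  ultimately have Q2: "2 / 3 \<le> ?Q" using zero_le_power2[of "a - 2 / 3"] by linarith
  have "43 / 100 \<le> sign_mean unit_ind 0 ([a, b, c] @ vs)"
  \<comment> \<open>With Q at least 2/3, this is the largest k compatible with level 4/8 at the
    origin: 43/100 + 21/100 * 1/3 = 1/2.\<close>
  proof (rule sign_mean_ge_of_parabola[where k = "21 / 100" and s = "1 - ?Q"])
    fix u :: real
    assume u: "0 \<le> u"
    have "0 \<le> c" using abc by linarith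
    note ge = sign_mean_3_ge[OF this abc(2,3,6) u]
    have r0: "a + b + c - 1 \<le> u" if "1 - \<bar>b + c - a\<bar> < u" using abc that by linarith
    consider "u \<le> 1 - \<bar>b + c - a\<bar>"
      | "1 - \<bar>b + c - a\<bar> < u" "u \<le> 1 + \<bar>b + c - a\<bar>" | "1 + \<bar>b + c - a\<bar> < u" "u \<le> 1 + (a - b + c)"
      | "1 + (a - b + c) < u" "u \<le> 1 + (a + b - c)" | "1 + (a + b - c) < u" "u \<le> 1 + (a + b + c)"
      | "1 + (a + b + c) < u" by linarith
    then show "43 / 100 + 21 / 100 * (1 - ?Q - u\<^sup>2) \<le> sign_mean unit_ind u [a, b, c]"
    proof cases
      case 1
      then show ?thesis using ge(3) Q2 zero_le_power2[of u] by argo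
    next
      case 2
      then show ?thesis using ge(5) r0 Q2 zero_le_power2[of u] by argo
    next
      case 3
      then have "1 * 1 \<le> u\<^sup>2" by (intro square_ge) auto
      then show ?thesis using ge(6) r0 3 Q2 abc by argo
    next
      case 4
      then have "(128 / 100) * (128 / 100) \<le> u\<^sup>2" using abc by (intro square_ge) linarith+
      then show ?thesis using ge(7) r0 4 Q2 abc by argo
    next
      case 5
      then have "(3 / 2) * (3 / 2) \<le> u\<^sup>2" using abc by (intro square_ge) linarith+
      then show ?thesis using ge(8) r0 5 Q2 abc by argo
    next
      case 6
      then have "2 * 2 \<le> u\<^sup>2" using abc by (intro square_ge) linarith+
      then show ?thesis using ge(9) Q2 by argo
    qed
  qed (use sum in auto)
  then show ?thesis by simp
qed

lemma sign_mean_ge_four: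
  assumes abcd: "49 / 200 \<le> d" "d \<le> c" "c \<le> b" "b \<le> a" "a + b + c \<le> 1"
    and sum: "sum_sq (a # b # c # d # vs) \<le> 1"
  shows "43 / 100 \<le> sign_mean unit_ind 0 (a # b # c # d # vs)"
proof -
  define Q where "Q = a\<^sup>2 + b\<^sup>2 + c\<^sup>2 + d\<^sup>2"
  have sq: "(49 / 200) * (49 / 200) \<le> d\<^sup>2" "d\<^sup>2 \<le> c\<^sup>2" "c\<^sup>2 \<le> b\<^sup>2" "b\<^sup>2 \<le> a\<^sup>2"
    using abcd square_ge[of "49 / 200" d] by (auto intro!: power_mono)
  then have Q: "2401 / 10000 \<le> Q" unfolding Q_def by argo
  have "43 / 100 \<le> sign_mean unit_ind 0 ([a, b, c, d] @ vs)"
  \<comment> \<open>Four weights of at least 49/200 keep the parabola below 93/100 - 2401/20000,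
    which is just under level 13/16.\<close>
  proof (rule sign_mean_ge_of_parabola[where k = "1 / 2" and s = "1 - Q"])
    fix u :: real
    assume u: "0 \<le> u"
    define r0 r1 r2 r3 r4 where r: "r0 = a + b + c + d" "r1 = a + b + c - d" "r2 = a + b - c + d"
      "r3 = a - b + c + d" "r4 = - a + b + c + d"
    define t1 t2 t3 where t: "t1 = a + b - c - d" "t2 = a - b + c - d" "t3 = \<bar>a + d - b - c\<bar>"
    have le: "0 \<le> t3" "t3 \<le> t2" "t2 \<le> t1" "t1 \<le> r3" "r3 \<le> r2" "r2 \<le> r1" "r1 \<le> 1"
      "0 \<le> r4" "r4 \<le> r3" "9 / 40 \<le> r4" "49 / 100 \<le> r3" "r0 - 1 \<le> 1 - r1" "49 / 50 \<le> r0" "r1 \<le> r0" "r0 \<le> 2"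
      using abcd unfolding r t by linarith+
    have eq: "sign_mean unit_ind u [a, b, c, d] =
      (pair_ind r0 u + pair_ind r1 u + pair_ind r2 u + pair_ind r3 u + pair_ind r4 u
        + pair_ind t1 u + pair_ind t2 u + pair_ind t3 u) / 16"
      unfolding r t by (rule sign_mean_4)
    have p0: "0 \<le> pair_ind r0 u" "0 \<le> pair_ind r1 u" "0 \<le> pair_ind r2 u" "0 \<le> pair_ind r3 u" "0 \<le> pair_ind r4 u"
      "0 \<le> pair_ind t1 u" "0 \<le> pair_ind t2 u" "0 \<le> pair_ind t3 u"
      by (rule pair_ind_nonneg)+
    have p1: "1 \<le> pair_ind r u" if "r \<in> {r1, r2, r3, r4, t1, t2, t3}" "u \<le> 1 + r" for r
      using that le u by (intro pair_ind_ge_1_of_nonneg) auto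
    have p2: "2 \<le> pair_ind r u" if "r \<in> {r1, r2, r3, r4, t1, t2, t3}" "u \<le> 1 - r" for r
      using that le u by (intro pair_ind_ge_2) auto
    have p1': "u \<le> 1 + r1 \<Longrightarrow> 1 \<le> pair_ind r1 u" "u \<le> 1 + r2 \<Longrightarrow> 1 \<le> pair_ind r2 u"
      "u \<le> 1 + r3 \<Longrightarrow> 1 \<le> pair_ind r3 u" "u \<le> 1 + r4 \<Longrightarrow> 1 \<le> pair_ind r4 u"
      "u \<le> 1 + t1 \<Longrightarrow> 1 \<le> pair_ind t1 u" "u \<le> 1 + t2 \<Longrightarrow> 1 \<le> pair_ind t2 u" "u \<le> 1 + t3 \<Longrightarrow> 1 \<le> pair_ind t3 u"
      by (rule p1; simp)+
    have p2': "u \<le> 1 - r1 \<Longrightarrow> 2 \<le> pair_ind r1 u" "u \<le> 1 - r2 \<Longrightarrow> 2 \<le> pair_ind r2 u"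
      "u \<le> 1 - r3 \<Longrightarrow> 2 \<le> pair_ind r3 u" "u \<le> 1 - r4 \<Longrightarrow> 2 \<le> pair_ind r4 u"
      "u \<le> 1 - t1 \<Longrightarrow> 2 \<le> pair_ind t1 u" "u \<le> 1 - t2 \<Longrightarrow> 2 \<le> pair_ind t2 u" "u \<le> 1 - t3 \<Longrightarrow> 2 \<le> pair_ind t3 u"
      by (rule p2; simp)+
    have p0': "1 \<le> pair_ind r0 u" if "1 - r1 \<le> u" "u \<le> 1 + r0"
      using that le u by (intro pair_ind_ge_1_of_nonneg) auto
    have sq_u: "x\<^sup>2 \<le> u\<^sup>2" if "0 \<le> x" "x \<le> u" for x
      using that by (intro power_mono)
    \<comment> \<open>Level j/16 has to dominate 93/100 - (Q + u^2)/2. The thresholds from here to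
      \<open>F_t3\<close> are 2 (93/100 - j/16) for j = 12, 11, 10, 9, 8. An early breakpoint forces
      large weights, so u and these weights cannot all be small; the square inequalities quantify
      this.\<close>
    have F_r3: "36 / 100 \<le> Q + u\<^sup>2" if "1 - r3 < u"
    proof -
      have "(1 - r3)\<^sup>2 \<le> u\<^sup>2" using that le by (intro sq_u) linarith+
      moreover have "(1 - d) * (1 - d) \<le> (1 - r3 + a)\<^sup>2" using abcd unfolding r by (intro square_ge) linarith+
      moreover have "(1 - d) * (1 - d) / 2 + 3 * d\<^sup>2 = 3 / 7 + 7 / 2 * (d - 1 / 7)\<^sup>2"
        by (simp add: power2_eq_square field_simps)
      ultimately show ?thesis
        using sum_two_squares_ge[of "1 - r3" a] sq zero_le_power2[of "d - 1 / 7"] unfolding Q_def by argo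
    qed
    have F_r4: "485 / 1000 \<le> Q + u\<^sup>2" if "1 - r4 < u"
    proof -
      have "(1 - (c + d))\<^sup>2 \<le> u\<^sup>2" using that abcd unfolding r by (intro sq_u) linarith+
      moreover have "(1 - (c + d))\<^sup>2 + (c + d)\<^sup>2 = 1 / 2 + 2 * (c + d - 1 / 2)\<^sup>2"
        by (simp add: power2_eq_square algebra_simps)
      ultimately show ?thesis
        using sum_two_squares_ge[of c d] sq zero_le_power2[of "c + d - 1 / 2"] unfolding Q_def by argo
    qed
    have F_t1: "61 / 100 \<le> Q + u\<^sup>2" if "1 - t1 < u"
    proof -
      have "(1 - t1)\<^sup>2 \<le> u\<^sup>2" using that le by (intro sq_u) linarith+
      moreover have "(149 / 100) * (149 / 100) \<le> (1 - t1 + a + b)\<^sup>2" using abcd unfolding t by (intro square_ge) linarith+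
      ultimately show ?thesis
        using sum_three_squares_ge[of "1 - t1" a b] sq zero_le_power2[of d] unfolding Q_def by argo
    qed
    have F_t2: "735 / 1000 \<le> Q + u\<^sup>2" if "1 - t2 < u"
    proof -
      have "(1 - t2)\<^sup>2 \<le> u\<^sup>2" using that le by (intro sq_u) linarith+
      moreover have "(149 / 100) * (149 / 100) \<le> (1 - t2 + a + c)\<^sup>2" using abcd unfolding t by (intro square_ge) linarith+
      ultimately show ?thesis
        using sum_three_squares_ge[of "1 - t2" a c] sq unfolding Q_def by argo
    qed
    have F_t3: "86 / 100 \<le> Q + u\<^sup>2" if "1 - t3 < u"
    proof (cases "b + c \<le> a + d")
      case True
      have "(1 - t3)\<^sup>2 \<le> u\<^sup>2" using that le by (intro sq_u) linarith+
      moreover have "(249 / 200) * (249 / 200) \<le> (1 - t3 + a)\<^sup>2"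
        using True abcd unfolding t by (intro square_ge) linarith+
      ultimately show ?thesis
        using sum_two_squares_ge[of "1 - t3" a] sq unfolding Q_def by argo
    next
      case False
      have "(1 - c + d)\<^sup>2 \<le> u\<^sup>2" using False that abcd unfolding t by (intro sq_u) linarith+
      moreover have "(249 / 200) * (249 / 200) \<le> (1 - c + d + c)\<^sup>2"
        using abcd by (intro square_ge) linarith+
      ultimately show ?thesis
        using sum_two_squares_ge[of "1 - c + d" c] sq unfolding Q_def by argo
    qed
    have F_1: "1 \<le> u\<^sup>2" if "1 \<le> u" using square_ge[of 1 u] that by simp
    have F_2: "3 / 2 \<le> u\<^sup>2" if "1 + r4 < u"
    proof -
      have "(49 / 40) * (49 / 40) \<le> u\<^sup>2" using that le by (intro square_ge) linarith+
      then show ?thesis by simp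
    qed
    have F_3: "2 \<le> u\<^sup>2" if "1 + r3 < u"
    proof -
      have "(149 / 100) * (149 / 100) \<le> u\<^sup>2" using that le by (intro square_ge) linarith+
      then show ?thesis by simp
    qed
    note u2 = zero_le_power2[of u]
    have "93 / 100 - (Q + u\<^sup>2) / 2 \<le>
      (pair_ind r0 u + pair_ind r1 u + pair_ind r2 u + pair_ind r3 u + pair_ind r4 u
        + pair_ind t1 u + pair_ind t2 u + pair_ind t3 u) / 16"
    proof -
      \<comment> \<open>The position of r4 among t1, t2, t3 is not determined, hence the extra
        splits at 1 - r4 and 1 + r4.\<close>
      consider "u \<le> 1 - r1" | "1 - r1 < u" "u \<le> 1 - r2" | "1 - r2 < u" "u \<le> 1 - r3"
        | "1 - r3 < u" "u \<le> 1 - t1" "u \<le> 1 - r4" | "1 - r3 < u" "u \<le> 1 - t1" "1 - r4 < u"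
        | "1 - t1 < u" "u \<le> 1 - t2" | "1 - t2 < u" "u \<le> 1 - t3" | "1 - t3 < u" "u \<le> 1"
        | "1 < u" "u \<le> 1 + r4" "u \<le> 1 + t3"
        | "1 < u" "u \<le> 1 + r4" "1 + t3 < u" "u \<le> 1 + t2" | "1 < u" "u \<le> 1 + r4" "1 + t2 < u" "u \<le> 1 + t1"
        | "1 < u" "u \<le> 1 + r4" "1 + t1 < u" | "1 + r4 < u" "u \<le> 1 + r3" | "1 + r3 < u" "u \<le> 1 + r2"
        | "1 + r2 < u" "u \<le> 1 + r1" | "1 + r1 < u" "u \<le> 1 + r0" | "1 + r0 < u"
        by argo
      then show ?thesis
      proof cases
        case 1
        then show ?thesis using p0 p2' le Q u2 by argo
      next
        case 2
        then show ?thesis using p0 p0' p1'(1) p2'(2-7) le Q u2 by argo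
      next
        case 3
        then show ?thesis using p0' p1'(1,2) p2'(3-7) le Q u2 by argo
      next
        case 4
        then show ?thesis using p0' p1'(1-3) p2'(4-7) le F_r3 by argo
      next
        case 5
        then show ?thesis using p0' p1'(1-4) p2'(5-7) le F_r4 by argo
      next
        case 6
        then show ?thesis using p0' p1'(1-5) p2'(6-7) le F_t1 by argo
      next
        case 7
        then show ?thesis using p0' p1'(1-6) p2'(7) le F_t2 by argo
      next
        case 8
        then show ?thesis using p0' p1' le F_t3 by argo
      next
        case 9
        then show ?thesis using p0' p1' le Q F_1 by argo
      next
        case 10
        then show ?thesis using p0 p0' p1'(1-6) le Q F_1 by argo
      next
        case 11
        then show ?thesis using p0 p0' p1'(1-5) le Q F_1 by argo
      next
        case 12
        then show ?thesis using p0 p0' p1'(1-4) le Q F_1 by argo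
      next
        case 13
        then show ?thesis using p0 p0' p1'(1-3) le Q F_2 by argo
      next
        case 14
        then show ?thesis using p0 p0' p1'(1-2) le Q F_3 by argo
      next
        case 15
        then show ?thesis using p0 p0' p1'(1) le Q F_3 by argo
      next
        case 16
        then show ?thesis using p0 p0' le Q F_3 by argo
      next
        case 17
        then show ?thesis using p0 le Q F_3 by argo
      qed
    qed
    then show "43 / 100 + 1 / 2 * (1 - Q - u\<^sup>2) \<le> sign_mean unit_ind u [a, b, c, d]"
      unfolding eq by argo
  qed (use sum in \<open>auto simp: Q_def\<close>)
  then show ?thesis by simp
qed

section \<open>Small remaining weights\<close>

lemma sign_mean_2_ge:
  assumes "b \<le> a" "a \<le> 1" "1 \<le> a + b"
  shows "\<bar>u\<bar> \<le> 1 + (a - b) \<Longrightarrow> 1 / 2 \<le> sign_mean unit_ind u [a, b]"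
    and "a + b - 1 \<le> \<bar>u\<bar> \<Longrightarrow> \<bar>u\<bar> \<le> 1 - (a - b) \<Longrightarrow> 3 / 4 \<le> sign_mean unit_ind u [a, b]"
    and "\<bar>u\<bar> \<le> 1 + (a + b) \<Longrightarrow> 1 / 4 \<le> sign_mean unit_ind u [a, b]"
    and "0 \<le> sign_mean unit_ind u [a, b]"
proof -
  define w where "w = \<bar>u\<bar>"
  have n: "0 \<le> pair_ind (a + b) u" "0 \<le> pair_ind (a - b) u" by (rule pair_ind_nonneg)+
  have p: "1 \<le> pair_ind (a + b) u" if "a + b - 1 \<le> w" "w \<le> 1 + (a + b)"
    using that assms unfolding w_def by (intro pair_ind_ge_1) linarith
  have q: "1 \<le> pair_ind (a - b) u" if "w \<le> 1 + (a - b)"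
    using that assms unfolding w_def by (intro pair_ind_ge_1) linarith
  have q2: "2 \<le> pair_ind (a - b) u" if "w \<le> 1 - (a - b)"
    using that assms pair_ind_eq_2[of u "a - b"] unfolding w_def by linarith
  have *: "1 / 2 \<le> sign_mean unit_ind u [a, b]" if "w \<le> 1 + (a - b)"
    using that n p q q2 assms unfolding sign_mean_2 by argo
  then show "1 / 2 \<le> sign_mean unit_ind u [a, b]" if "\<bar>u\<bar> \<le> 1 + (a - b)"
    using that by (simp only: w_def)
  show "3 / 4 \<le> sign_mean unit_ind u [a, b]" if u: "a + b - 1 \<le> \<bar>u\<bar>" "\<bar>u\<bar> \<le> 1 - (a - b)"
  proof -
    have "1 \<le> pair_ind (a + b) u" using u assms unfolding w_def[symmetric] by (intro p) linarith+
    moreover have "2 \<le> pair_ind (a - b) u" using u unfolding w_def[symmetric] by (intro q2)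
    ultimately show ?thesis unfolding sign_mean_2 by simp
  qed
  show "1 / 4 \<le> sign_mean unit_ind u [a, b]" if "\<bar>u\<bar> \<le> 1 + (a + b)"
  proof (cases "a + b - 1 \<le> w")
    case True
    then have "1 \<le> pair_ind (a + b) u" using that unfolding w_def[symmetric] by (intro p)
    then show ?thesis using n unfolding sign_mean_2 by simp
  next
    case False
    then have "w \<le> 1 + (a - b)" using assms by linarith
    from *[OF this] show ?thesis by linarith
  qed
  show "0 \<le> sign_mean unit_ind u [a, b]"
    using n unfolding sign_mean_2 by argo
qed

text \<open>As a function of the remaining sum, the mean over the first two signs is 3/4 on
  \<open>\<delta> \<le> |u| \<le> 1 - q\<close>. The walk is stopped just before it leaves this region; a continuation that
  lowers the mean is then compensated by its reflection.\<close>

lemma sign_mean_ge_two_big_rest_small: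
  fixes a b :: real and vs :: "real list"
  defines "q \<equiv> a - b" and "\<delta> \<equiv> a + b - 1" and "s \<equiv> 1 - a\<^sup>2 - b\<^sup>2"
  assumes ab: "b \<le> a" "a \<le> 1" "1 \<le> a + b"
    and s: "28 / 100 * (1 + q)\<^sup>2 < s"
    and small: "\<And>v. v \<in> set vs \<Longrightarrow> \<bar>v\<bar> \<le> \<delta>"
    and sum: "sum_sq (a # b # vs) \<le> 1"
  shows "43 / 100 \<le> sign_mean unit_ind 0 (a # b # vs)"
proof -
  \<comment> \<open>A step of at most \<delta> from [-\<xi>, \<xi>] stays within 1 - q, and a walk
    stopped beyond \<xi> is more than y away from the dip |u| < \<delta>. The parabola with
    coefficient \<kappa> loses 1/8 at y and 1/2 at 2 y; \<rho> spends the allowance 7/100 over the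
    variance s.\<close>
  define \<xi> y \<kappa> \<rho> where "\<xi> = 1 - q - \<delta>" and "y = \<xi> - \<delta>" and "\<kappa> = 1 / (8 * y\<^sup>2)" and "\<rho> = 7 / 100 / s"
  let ?H = "\<lambda>u. sign_mean unit_ind u [a, b]"
  have q: "0 \<le> q" and \<delta>: "0 \<le> \<delta>" and a\<delta>: "\<delta> \<le> 1 - q"
    using ab unfolding q_def \<delta>_def by linarith+
  have s_eq: "2 * s = 1 - 2 * \<delta> - \<delta>\<^sup>2 - q\<^sup>2"
    unfolding s_def \<delta>_def q_def by (simp add: power2_eq_square algebra_simps)
  have s_ge: "28 / 100 \<le> s"
  proof -
    have "1 * 1 \<le> (1 + q)\<^sup>2" using q by (intro square_ge) auto
    then show ?thesis using s by argo
  qed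
  have \<delta>_le: "\<delta> \<le> 22 / 100 - 56 / 100 * q - 78 / 100 * q\<^sup>2"
  proof -
    have "(1 + q)\<^sup>2 = 1 + 2 * q + q\<^sup>2" by (simp add: power2_eq_square algebra_simps)
    then show ?thesis using s s_eq zero_le_power2[of \<delta>] by argo
  qed
  have y_ge: "3 / 2 * s \<le> y"
  proof -
    have "14 / 100 - 72 / 100 * q + 114 / 100 * q\<^sup>2 = 114 / 100 * (q - 36 / 114)\<^sup>2 + 14 / 100 - 1296 / 11400"
      by (simp add: power2_eq_square field_simps)
    then show ?thesis
      using s_eq \<delta>_le zero_le_power2[of \<delta>] zero_le_power2[of "q - 36 / 114"] unfolding y_def \<xi>_def by argo
  qed
  have \<xi>_ge: "7179 / 10000 \<le> \<xi>"
  proof -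
    have "44 / 100 * q - 78 / 100 * q\<^sup>2 = 484 / 7800 - 78 / 100 * (q - 22 / 78)\<^sup>2"
      by (simp add: power2_eq_square field_simps)
    then show ?thesis
      using \<delta>_le zero_le_power2[of "q - 22 / 78"] unfolding \<xi>_def by argo
  qed
  have "0 < y" using y_ge s_ge by linarith
  then have "0 < \<kappa>" unfolding \<kappa>_def by simp
  have "0 < \<rho>" using s_ge unfolding \<rho>_def by simp
  \<comment> \<open>This is the worst stop: at \<xi>, with all of s still left. It amounts to s^2
    \<le> 56/100 * y^2 (\<xi>^2 + s), and 9/4 * 795/1000 * 56/100 is barely above 1.\<close>
  have key: "\<kappa> * s \<le> \<rho> * (\<xi>\<^sup>2 + s)"
  proof -
    have "(3 / 2 * s)\<^sup>2 \<le> y\<^sup>2" using y_ge s_ge by (intro power_mono) auto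
    then have "9 / 4 * s\<^sup>2 \<le> y\<^sup>2" by (simp add: power_mult_distrib power2_eq_square)
    moreover have "795 / 1000 \<le> \<xi>\<^sup>2 + s"
      using square_ge[OF _ \<xi>_ge] s_ge by simp
    ultimately have "9 / 4 * s\<^sup>2 * (795 / 1000) \<le> y\<^sup>2 * (\<xi>\<^sup>2 + s)"
      by (intro mult_mono) auto
    then have "s\<^sup>2 \<le> 56 / 100 * (y\<^sup>2 * (\<xi>\<^sup>2 + s))"
      using zero_le_power2[of s] by argo
    then show ?thesis
      unfolding \<kappa>_def \<rho>_def using \<open>0 < y\<close> s_ge by (simp add: field_simps power2_eq_square)
  qed
  have pointwise: "1 / 2 - \<kappa> * t\<^sup>2 \<le> (?H (x + t) + ?H (x - t)) / 2"
    if x: "\<xi> < x" "x \<le> 1 - q" and t: "0 \<le> t" for x t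
  proof -
    note H = sign_mean_2_ge[OF ab, folded q_def]
    have nonneg: "0 \<le> \<kappa> * t\<^sup>2" using \<open>0 < \<kappa>\<close> by simp
    have large: "\<kappa> * z\<^sup>2 \<le> \<kappa> * t\<^sup>2" if "0 \<le> z" "z \<le> t" for z
      using that \<open>0 < \<kappa>\<close> by (simp add: power_mono)
    have \<kappa>y: "\<kappa> * y\<^sup>2 = 1 / 8" "\<kappa> * (2 * y)\<^sup>2 = 1 / 2"
      using \<open>0 < y\<close> unfolding \<kappa>_def by (simp_all add: power_mult_distrib)
    have x\<delta>: "\<delta> < x" "y < x - \<delta>" using x(1) \<open>0 < y\<close> unfolding y_def by linarith+
    have p: "1 + (a + b) = 2 + \<delta>" unfolding \<delta>_def by simp
    \<comment> \<open>The mean of the values at x - t and x + t is bounded below by (3/4 + 1/4)/2,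
      (1/2 + 1/4)/2, (3/4 + 0)/2 and 0 in turn: losses 0, 1/8, 1/8 and 1/2.\<close>
    consider "t \<le> x - \<delta>" | "x - \<delta> < t" "t < x + \<delta>" | "x + \<delta> \<le> t" "t \<le> x + 1 - q" | "x + 1 - q < t"
      by linarith
    then show ?thesis
    proof cases
      case 1
      have "\<delta> \<le> \<bar>x - t\<bar>" "\<bar>x - t\<bar> \<le> 1 - q" using 1 t x \<delta> by linarith+
      then have "3 / 4 \<le> ?H (x - t)" unfolding \<delta>_def by (rule H(2))
      moreover have "\<bar>x + t\<bar> \<le> 1 + (a + b)" using 1 t x \<delta> q x\<delta> unfolding p by linarith
      then have "1 / 4 \<le> ?H (x + t)" by (rule H(3))
      ultimately show ?thesis using nonneg by argo
    next
      case 2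
      have "\<bar>x - t\<bar> \<le> 1 + q" using 2 a\<delta> q by linarith
      then have "1 / 2 \<le> ?H (x - t)" by (rule H(1))
      moreover have "\<bar>x + t\<bar> \<le> 1 + (a + b)" using 2 t x \<delta> q x\<delta> unfolding p by linarith
      then have "1 / 4 \<le> ?H (x + t)" by (rule H(3))
      ultimately show ?thesis using large[of y] 2 x\<delta> \<open>0 < y\<close> \<kappa>y by argo
    next
      case 3
      have "\<delta> \<le> \<bar>x - t\<bar>" "\<bar>x - t\<bar> \<le> 1 - q" using 3 \<delta> by linarith+
      then have "3 / 4 \<le> ?H (x - t)" unfolding \<delta>_def by (rule H(2))
      then show ?thesis using large[of y] 3 \<delta> x\<delta> \<open>0 < y\<close> \<kappa>y H(4)[of "x + t"] by argo
    next
      case 4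
      have "\<kappa> * (2 * y)\<^sup>2 \<le> \<kappa> * t\<^sup>2" using 4 x \<delta> x\<delta> \<open>0 < y\<close> by (intro large) linarith+
      then show ?thesis using \<kappa>y H(4)[of "x + t"] H(4)[of "x - t"] by argo
    qed
  qed
  have even: "?H (- u) = ?H u" for u by (rule sign_mean_unit_ind_minus)
  have pointwise': "1 / 2 - \<kappa> * t\<^sup>2 \<le> (?H (x + t) + ?H (x - t)) / 2"
    if x: "\<xi> < \<bar>x\<bar>" "\<bar>x\<bar> \<le> 1 - q" for x t
  proof -
    have "?H (\<bar>x\<bar> + \<bar>t\<bar>) + ?H (\<bar>x\<bar> - \<bar>t\<bar>) = ?H (x + t) + ?H (x - t)"
      using even[of "x + t"] even[of "x - t"] by (auto simp: abs_if algebra_simps minus_diff_commute simp del: sign_mean.simps)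
    then show ?thesis using pointwise[OF x, of "\<bar>t\<bar>"] by simp
  qed
  have "1 / 2 - \<rho> * (0\<^sup>2 + sum_sq vs) \<le> sign_mean ?H 0 vs"
  proof (rule sign_mean_stopping[where \<xi> = \<xi> and c = \<delta> and S = s])
    fix x assume "\<bar>x\<bar> \<le> \<xi>"
    then have "1 / 2 \<le> ?H x" using q \<delta> unfolding \<xi>_def q_def by (intro sign_mean_2_ge(1)[OF ab]) linarith
    moreover have "0 \<le> \<rho> * x\<^sup>2" using \<open>0 < \<rho>\<close> by simp
    ultimately show "1 / 2 - \<rho> * x\<^sup>2 \<le> ?H x" by argo
  next
    fix x ws
    assume x: "\<xi> < \<bar>x\<bar>" "\<bar>x\<bar> \<le> \<xi> + \<delta>" and ws: "sum_sq ws \<le> s"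
    \<comment> \<open>The claim is affine in the remaining variance. For \<kappa> > \<rho> it is
      tightest at s, where \<open>key\<close> applies.\<close>
    have "\<kappa> * sum_sq ws \<le> \<rho> * (x\<^sup>2 + sum_sq ws)"
    proof (cases "\<kappa> \<le> \<rho>")
      case True
      have "\<kappa> * sum_sq ws \<le> \<rho> * sum_sq ws" using True sum_sq_nonneg by (intro mult_right_mono)
      moreover have "0 \<le> \<rho> * x\<^sup>2" using \<open>0 < \<rho>\<close> by simp
      ultimately show ?thesis by (simp add: algebra_simps)
    next
      case False
      have "(\<kappa> - \<rho>) * sum_sq ws \<le> (\<kappa> - \<rho>) * s" using False ws by (intro mult_left_mono) auto
      moreover have "\<xi>\<^sup>2 \<le> x\<^sup>2" using x \<xi>_ge by (intro iffD1[OF abs_le_square_iff]) auto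
      then have "\<rho> * \<xi>\<^sup>2 \<le> \<rho> * x\<^sup>2" using \<open>0 < \<rho>\<close> by simp
      ultimately show ?thesis using key by (simp add: algebra_simps)
    qed
    then have "1 / 2 - \<rho> * (x\<^sup>2 + sum_sq ws) \<le> 1 / 2 - \<kappa> * (0\<^sup>2 + sum_sq ws)" by simp
    also have "\<dots> = sign_mean (\<lambda>t. 1 / 2 - \<kappa> * t\<^sup>2) 0 ws"
      by (rule sign_mean_parabola[symmetric])
    also have "\<dots> \<le> sign_mean (\<lambda>t. (?H (x + t) + ?H (x - t)) / 2) 0 ws"
      using x by (intro sign_mean_mono pointwise') (simp_all add: \<xi>_def)
    also have "\<dots> = sign_mean ?H x ws"
      by (rule sign_mean_symmetrize[symmetric])
    finally show "1 / 2 - \<rho> * (x\<^sup>2 + sum_sq ws) \<le> sign_mean ?H x ws" .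
  qed (use small sum \<xi>_ge \<delta> in \<open>auto simp: s_def\<close>)
  moreover have "\<rho> * sum_sq vs \<le> \<rho> * s"
    using sum \<open>0 < \<rho>\<close> by (simp add: s_def)
  moreover have "\<rho> * s = 7 / 100" using s_ge unfolding \<rho>_def by simp
  ultimately have "43 / 100 \<le> sign_mean ?H 0 vs" by simp
  then show ?thesis
    using sign_mean_prefix[of unit_ind 0 "[a, b]" vs] by simp
qed

lemma sign_mean_nonneg: "0 \<le> sign_mean unit_ind x vs"
  using sign_mean_mono[of "\<lambda>u. 0 - 0 * u\<^sup>2" unit_ind x vs] sign_mean_parabola[of 0 0 x vs]
  by (simp add: unit_ind_def)

lemma sign_mean_move: "sign_mean g x (ws @ a # vs) = sign_mean g x (a # ws @ vs)"
proof -
  have "sign_mean g x (ws @ [a] @ vs) = sign_mean (\<lambda>u. sign_mean (\<lambda>w. sign_mean g w vs) u [a]) x ws"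
    by (simp only: sign_mean_append)
  also have "\<dots> = sign_mean (\<lambda>u. sign_mean (\<lambda>w. sign_mean g w vs) u ws) x [a]"
    by (rule sign_mean_commute)
  also have "\<dots> = sign_mean g x ([a] @ ws @ vs)"
    by (simp only: sign_mean_append)
  finally show ?thesis by simp
qed

text \<open>The factor 13/80 is a value of \<open>B\<close> admissible for \<open>\<alpha> = 49/200\<close> in
  \<open>sign_mean_ge_of_small_steps\<close>.\<close>

lemma sign_mean_ge_rest_small:
  assumes "(\<Sum>w\<leftarrow>ws. \<bar>w\<bar>) \<le> 1" "\<And>v. v \<in> set vs \<Longrightarrow> \<bar>v\<bar> \<le> 49 / 200" "sum_sq (ws @ vs) \<le> 1"
  shows "43 / 100 \<le> sign_mean unit_ind 0 (ws @ vs)"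
proof -
  \<comment> \<open>All partial sums over \<open>ws\<close> stay in [-1, 1], so stopping need only
    start after them. Averaging over a sign of \<open>ws\<close> preserves the bound, since it
    involves only x^2 plus the remaining variance.\<close>
  have "1 / 2 + 13 / 80 * ((151 / 200)\<^sup>2 - x\<^sup>2 - sum_sq (ws @ vs)) \<le> sign_mean unit_ind x (ws @ vs)"
    if "\<bar>x\<bar> + (\<Sum>w\<leftarrow>ws. \<bar>w\<bar>) \<le> 1" for x
    using that
  proof (induction ws arbitrary: x)
    case Nil
    show ?case
      using sign_mean_ge_of_small_steps[of x vs "49 / 200" "13 / 80"] assms(2) Nil
      by (simp add: power2_eq_square)
  next
    case (Cons w ws)
    have "\<bar>x + w\<bar> + (\<Sum>w\<leftarrow>ws. \<bar>w\<bar>) \<le> 1" "\<bar>x - w\<bar> + (\<Sum>w\<leftarrow>ws. \<bar>w\<bar>) \<le> 1"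
      using Cons.prems by auto
    note IH = this[THEN Cons.IH]
    have "(x + w)\<^sup>2 + (x - w)\<^sup>2 = 2 * (x\<^sup>2 + w\<^sup>2)"
      by (simp add: power2_eq_square algebra_simps)
    with IH show ?case
      by (simp only: append_Cons list.map sum_list.Cons sign_mean.simps) argo
  qed
  from this[of 0] have *: "1 / 2 + 13 / 80 * ((151 / 200)\<^sup>2 - 0\<^sup>2 - sum_sq (ws @ vs)) \<le> sign_mean unit_ind 0 (ws @ vs)"
    using assms(1) by (simp only: abs_zero add_0)
  \<comment> \<open>At S = 1 the right side exceeds 43/100 by little more than 1/10000, so the
    threshold 49/200 leaves almost no slack.\<close>
  have "43 / 100 \<le> 1 / 2 + 13 / 80 * ((151 / 200)\<^sup>2 - 0\<^sup>2 - S)" if "S \<le> 1" for S :: real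
    using that by (simp add: power2_eq_square field_simps)
  from order_trans[OF this[OF assms(3)] *] show ?thesis .
qed

text \<open>Up to a global sign, the first three signs lead to four starting points. From a + b + c
  only nonnegativity is used; the other three lie in [-1, 1], where the stopping bound for small
  steps applies.\<close>

lemma sign_mean_ge_three_rest_small:
  assumes abc: "0 \<le> c" "c \<le> b" "b \<le> a" "1 \<le> b + c" "a + b - c \<le> 1"
    and small: "\<And>v. v \<in> set vs \<Longrightarrow> \<bar>v\<bar> \<le> b + c - 1"
    and sum: "sum_sq (a # b # c # vs) \<le> 1"
  shows "43 / 100 \<le> sign_mean unit_ind 0 (a # b # c # vs)"
proof -
  define p where "p = b + c"
  define S where "S r = sign_mean unit_ind r vs" for r
  \<comment> \<open>With \<alpha> = p - 1 this B gives equality in the second condition of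
    \<open>sign_mean_ge_of_small_steps\<close>, so the constant term of the bound becomes 1.\<close>
  define B where "B = 1 / (2 * (2 - p)\<^sup>2)"
  let ?Q = "a\<^sup>2 + b\<^sup>2 + c\<^sup>2"
  have Q: "?Q \<le> 1" using sum sum_sq_nonneg[of vs] by simp
  have "a + b + c \<le> 2" using sum_three_le_2[OF Q] .
  then have p: "1 \<le> p" "p < 2" "3 / 2 * p \<le> a + b + c"
    using abc unfolding p_def by argo+
  then have "0 < (2 - p)\<^sup>2" by simp
  have S_even: "S (- r) = S r" for r
    unfolding S_def by (rule sign_mean_unit_ind_minus)
  have "sign_mean unit_ind 0 (a # b # c # vs) =
      (S (a + b + c) + S (a + b - c) + S (a - b + c) + S (a - b - c)
        + S (- (a - b - c)) + S (- (a - b + c)) + S (- (a + b - c)) + S (- (a + b + c))) / 8"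
    by (simp add: S_def add_divide_distrib algebra_simps)
  also have "\<dots> = (S (a + b + c) + S (a + b - c) + S (a - b + c) + S (a - b - c)) / 4"
    unfolding S_even by simp
  finally have eq: "sign_mean unit_ind 0 (a # b # c # vs) =
      (S (a + b + c) + S (a + b - c) + S (a - b + c) + S (a - b - c)) / 4" .
  have B: "2 * B * (2 - p)\<^sup>2 = 1" using p unfolding B_def by simp
  then have "0 < 2 * B * (2 - p)\<^sup>2" by simp
  then have "0 < B" by (simp add: zero_less_mult_iff)
  have S_ge: "1 - B * (r\<^sup>2 + sum_sq vs) \<le> S r" if "\<bar>r\<bar> \<le> 1" for r
  proof -
    have "(2 - p)\<^sup>2 \<le> (2 - (p - 1))\<^sup>2" using p by (intro power_mono) auto
    then have "2 * B * (2 - p)\<^sup>2 \<le> 2 * B * (2 - (p - 1))\<^sup>2" using \<open>0 < B\<close> by simp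
    then have B1: "1 \<le> 2 * B * (2 - (p - 1))\<^sup>2" using B by simp
    have eq: "1 - (p - 1) = 2 - p" by simp
    then have B2: "2 * B * (1 - (p - 1))\<^sup>2 \<le> 1" using B by simp
    have "\<bar>v\<bar> \<le> p - 1" if "v \<in> set vs" for v
      using small[OF that] unfolding p_def .
    moreover have "0 \<le> p - 1" "p - 1 \<le> 1" using p by linarith+
    ultimately have "1 / 2 + B * ((1 - (p - 1))\<^sup>2 - r\<^sup>2 - sum_sq vs) \<le> S r"
      unfolding S_def by (rule sign_mean_ge_of_small_steps[OF that _ _ _ B1 B2])
    then have "1 / 2 + (B * (2 - p)\<^sup>2 - B * (r\<^sup>2 + sum_sq vs)) \<le> S r"
      unfolding eq by (simp only: diff_diff_add right_diff_distrib)
    then show ?thesis using B by argo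
  qed
  define X where "X r = r\<^sup>2 + sum_sq vs" for r
  have "1 - B * X (a + b - c) \<le> S (a + b - c)" "1 - B * X (a - b + c) \<le> S (a - b + c)"
    "1 - B * X (a - b - c) \<le> S (a - b - c)"
    using abc unfolding X_def by (intro S_ge; linarith)+
  moreover have "0 \<le> S (a + b + c)" unfolding S_def by (rule sign_mean_nonneg)
  moreover
  have "X (a + b - c) + X (a - b + c) + X (a - b - c) = 4 * ?Q - (a + b + c)\<^sup>2 + 3 * sum_sq vs"
    unfolding X_def by (simp add: power2_eq_square algebra_simps)
  then have eq1: "B * X (a + b - c) + B * X (a - b + c) + B * X (a - b - c)
      = B * (4 * ?Q - (a + b + c)\<^sup>2 + 3 * sum_sq vs)"
    by (metis distrib_left)
  \<comment> \<open>The factor 256/100 is what the goal asks for: it bounds the total loss by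
    128/100, and (3 - 128/100)/4 = 43/100.\<close>
  have le1: "B * (4 * ?Q - (a + b + c)\<^sup>2 + 3 * sum_sq vs) \<le> B * (256 / 100 * (2 - p)\<^sup>2)"
  proof (intro mult_left_mono)
    have "(3 / 2 * p)\<^sup>2 \<le> (a + b + c)\<^sup>2" using p by (intro power_mono) auto
    moreover have "256 / 100 * (2 - p)\<^sup>2 - (4 - (3 / 2 * p)\<^sup>2) = 481 / 100 * (p - 512 / 481)\<^sup>2 + (624 / 100 - 262144 / 48100)"
      by (simp add: power2_eq_square field_simps)
    moreover have sum': "?Q + sum_sq vs \<le> 1" using sum by simp
    ultimately show "4 * ?Q - (a + b + c)\<^sup>2 + 3 * sum_sq vs \<le> 256 / 100 * (2 - p)\<^sup>2"
      using sum' Q zero_le_power2[of "p - 512 / 481"] by argo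
  qed (use \<open>0 < B\<close> in simp)
  have eq2: "B * (256 / 100 * (2 - p)\<^sup>2) = 128 / 100" using B by simp
  have "B * X (a + b - c) + B * X (a - b + c) + B * X (a - b - c) \<le> 128 / 100"
    using le1 unfolding eq1[symmetric] eq2 .
  ultimately show ?thesis unfolding eq by argo
qed

section \<open>The case distinction\<close>

lemma sign_mean_ge_43_of_sorted:
  assumes sorted: "0 \<le> d" "d \<le> c" "c \<le> b" "b \<le> a" "\<And>v. v \<in> set vs \<Longrightarrow> 0 \<le> v \<and> v \<le> d"
    and sum: "sum_sq (a # b # c # d # vs) \<le> 1"
  shows "43 / 100 \<le> sign_mean unit_ind 0 (a # b # c # d # vs)"
proof -
  have Q: "a\<^sup>2 + b\<^sup>2 + c\<^sup>2 + d\<^sup>2 \<le> 1" using sum sum_sq_nonneg[of vs] by simp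
  have rest: "\<bar>v\<bar> \<le> d" if "v \<in> set vs" for v using sorted(5)[OF that] by simp
  have rest_d: "\<bar>v\<bar> \<le> d" if "v \<in> set (d # vs)" for v using rest that sorted(1) by auto
  have rest_c: "\<bar>v\<bar> \<le> c" if "v \<in> set (c # d # vs)" for v using rest_d[of v] that sorted(1,2) by auto
  consider "72 / 100 \<le> a" | "a < 72 / 100" "a + b \<le> 1" | "a < 72 / 100" "1 < a + b" by linarith
  then show ?thesis
  proof cases
    case 1
    then show ?thesis using sum by (intro sign_mean_ge_one_big)
  next
    case 2
    consider "c \<le> 49 / 200" | "49 / 200 \<le> c" "1 \<le> a + b + c"
      | "49 / 200 \<le> c" "a + b + c \<le> 1" "d \<le> 49 / 200" | "a + b + c \<le> 1" "49 / 200 \<le> d" by linarith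
    then show ?thesis
    proof cases
      case 1
      have "43 / 100 \<le> sign_mean unit_ind 0 ([a, b] @ c # d # vs)"
        using 1 2 sorted(1-4) sum rest_c by (intro sign_mean_ge_rest_small) (simp, fastforce, simp)
      then show ?thesis by simp
    next
      case 2
      then show ?thesis using \<open>a + b \<le> 1\<close> sorted(3,4) sum by (intro sign_mean_ge_three_of_pair_le_1)
    next
      case 3
      have "43 / 100 \<le> sign_mean unit_ind 0 ([a, b, c] @ d # vs)"
        using 3 sorted(1-4) sum rest_d by (intro sign_mean_ge_rest_small) (simp, fastforce, simp)
      then show ?thesis by simp
    next
      case 4
      then show ?thesis using sorted(2-4) sum by (intro sign_mean_ge_four)
    qed
  next
    case 3
    define q s where "q = a - b" and "s = 1 - a\<^sup>2 - b\<^sup>2"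
    \<comment> \<open>If little variance is left, two signs and a parabola suffice. Otherwise c is
      either at most a + b - 1, the half-width of the dip, and stopping works, or it fills the dip.
      Then a + c and b + c are compared with 1, and finally d with b + c - 1.\<close>
    consider "s \<le> 28 / 100 * (1 + q)\<^sup>2" | "28 / 100 * (1 + q)\<^sup>2 < s" "c \<le> a + b - 1"
      | "a + b - c \<le> 1" "a + c \<le> 1" | "a + b - c \<le> 1" "1 \<le> a + c" "b + c \<le> 1"
      | "a + b - c \<le> 1" "1 \<le> b + c" "d \<le> b + c - 1" | "1 \<le> b + c" "b + c - 1 \<le> d" by linarith
    then show ?thesis
    proof cases
      case 1
      \<comment> \<open>The first entry serves the breakpoint 1 + a - b, the second 1 + a + b, which
        is at least 2. The condition on s and s \<le> 1/2 keep both within the allowance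
        7/100.\<close>
      define k where "k = max (1 / 4 / (1 + q)\<^sup>2) (1 / 8)"
      have "0 \<le> q" unfolding q_def using sorted by simp
      then have pos: "0 < (1 + q)\<^sup>2" by simp
      have "1 \<le> (a + b)\<^sup>2" using 3 by (simp add: one_le_power)
      then have "s \<le> 1 / 2" using sum_two_squares_ge[of a b] unfolding s_def by argo
      have "1 / 4 / (1 + q)\<^sup>2 * s \<le> 7 / 100"
        using 1 pos by (simp add: field_simps)
      then have "k * s \<le> 7 / 100"
        unfolding k_def max_def using \<open>s \<le> 1 / 2\<close> by simp
      moreover have "1 / 4 \<le> k * (1 + a - b)\<^sup>2"
      proof -
        have "1 / 4 = 1 / 4 / (1 + q)\<^sup>2 * (1 + q)\<^sup>2" using pos by simp
        also have "\<dots> \<le> k * (1 + q)\<^sup>2" unfolding k_def by (intro mult_right_mono) auto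
        finally show ?thesis by (simp add: q_def add_diff_eq)
      qed
      moreover have "1 / 2 \<le> k * (1 + a + b)\<^sup>2"
      proof -
        have "2 * 2 \<le> (1 + a + b)\<^sup>2" using 3 by (intro square_ge) auto
        then have "1 / 8 * 4 \<le> k * (1 + a + b)\<^sup>2" unfolding k_def by (intro mult_mono) auto
        then show ?thesis by simp
      qed
      ultimately show ?thesis
        using 3 sorted sum by (intro sign_mean_ge_two_big[where k = k]) (auto simp: s_def)
    next
      case 2
      have "\<bar>v\<bar> \<le> a + b - 1" if "v \<in> set (c # d # vs)" for v
        using rest_c[OF that] 2 by linarith
      then show ?thesis
        using 2 3 sorted sum unfolding q_def s_def by (intro sign_mean_ge_two_big_rest_small) auto
    next
      case 3
      then show ?thesis
        using \<open>1 < a + b\<close> \<open>a < 72 / 100\<close> sorted sum by (intro sign_mean_ge_three_of_pair_ge_1) auto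
    next
      case 4
      then show ?thesis
        using \<open>1 < a + b\<close> \<open>a < 72 / 100\<close> sorted sum by (intro sign_mean_ge_three_of_two_pairs_ge_1) auto
    next
      case 5
      have "\<bar>v\<bar> \<le> b + c - 1" if "v \<in> set (d # vs)" for v
        using rest_d[OF that] 5 by linarith
      then show ?thesis
        using 5 sorted sum by (intro sign_mean_ge_three_rest_small) auto
    next
      case 6
      have le: "b\<^sup>2 \<le> a\<^sup>2" "d\<^sup>2 \<le> c\<^sup>2" using sorted by (auto intro!: power_mono)
      have "(b + d)\<^sup>2 \<le> 1\<^sup>2" using sum_two_squares_ge[of b d] le Q by simp
      then have "b + d \<le> 1" by (rule power2_le_imp_le) simp
      have "b \<le> 3 / 4"
      proof (rule power2_le_imp_le)
        have "b\<^sup>2 \<le> 9 / 16"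
          using le Q zero_le_power2[of c] zero_le_power2[of d] by argo
        then show "b\<^sup>2 \<le> (3 / 4)\<^sup>2" by (simp add: power2_eq_square)
      qed simp
      \<comment> \<open>Now b, c, d satisfy the hypotheses for a pair summing to at least 1, and a
        is treated as one of the remaining weights.\<close>
      have "43 / 100 \<le> sign_mean unit_ind 0 (b # c # d # a # vs)"
        using 6 sorted sum \<open>b + d \<le> 1\<close> \<open>b \<le> 3 / 4\<close> by (intro sign_mean_ge_three_of_pair_ge_1) auto
      then show ?thesis
        using sign_mean_move[of unit_ind 0 "[b, c, d]" a vs] by (simp only: append_Cons append_Nil)
    qed
  qed
qed

section \<open>The Gaussian constant\<close>

lemma std_normal_density_has_derivative:
  "(std_normal_density has_real_derivative - (x * std_normal_density x)) (at x)"
proof -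
  have "((\<lambda>x. - x\<^sup>2 / 2) has_real_derivative - x) (at x)"
    by (rule DERIV_cong[OF DERIV_cdivide[OF DERIV_minus[OF DERIV_pow]]]) simp
  from DERIV_cmult[OF DERIV_fun_exp[OF this], of "1 / sqrt (2 * pi)"] show ?thesis
    unfolding std_normal_density_def[abs_def] by (simp add: mult_ac)
qed

text \<open>Single points are null, so the complement of {..a} can be replaced by the closed
  half-line, as the integral formula on {a..} requires.\<close>

lemma one_minus_Phi: "ennreal (1 - Phi a) = (\<integral>\<^sup>+x. ennreal (std_normal_density x) * indicator {a..} x \<partial>lborel)"
proof -
  let ?M = "density lborel std_normal_density"
  interpret prob_space ?M by (rule prob_space_normal_density) simp
  have "emeasure ?M {a} = (\<integral>\<^sup>+x. ennreal (std_normal_density x) * indicator {a} x \<partial>lborel)"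
    by (simp add: emeasure_density)
  also have "\<dots> = (\<integral>\<^sup>+x. 0 \<partial>(lborel :: real measure))"
    by (intro nn_integral_cong_AE) (use AE_lborel_singleton[of a] in eventually_elim, auto)
  finally have "prob {a} = 0"
    by (simp add: measure_def)
  moreover have "prob ({..a} \<union> {a<..}) = prob {..a} + prob {a<..}"
    by (intro finite_measure_Union) auto
  moreover have "prob ({a} \<union> {a<..}) = prob {a} + prob {a<..}"
    by (intro finite_measure_Union) auto
  moreover have "{a} \<union> {a<..} = {a..}" "{..a} \<union> {a<..} = space ?M"
    by auto
  moreover have "prob UNIV = 1"
    using prob_space by simp
  ultimately have "1 - Phi a = prob {a..}"
    by (simp add: Phi_def)
  also have "ennreal \<dots> = emeasure ?M {a..}"
    by (simp add: emeasure_eq_measure)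
  finally show ?thesis
    by (simp add: emeasure_density)
qed

text \<open>The density f satisfies f' = -x f, so -f R is an antiderivative of f w. For w = 1 such
  an R is the Mills ratio; an R with w \<le> 1 or w \<ge> 1 bounds the tail from below or
  above.\<close>

lemma nn_integral_std_normal_tail:
  assumes [measurable]: "w \<in> borel_measurable borel"
    and w_nonneg: "\<And>x. a \<le> x \<Longrightarrow> 0 \<le> w x"
    and R: "\<And>x. a \<le> x \<Longrightarrow> (R has_real_derivative x * R x - w x) (at x)"
    and lim: "((\<lambda>x. std_normal_density x * R x) \<longlongrightarrow> 0) at_top"
  shows "(\<integral>\<^sup>+x. ennreal (std_normal_density x * w x) * indicator {a..} x \<partial>lborel)
    = ennreal (std_normal_density a * R a)"
proof -
  have "((\<lambda>x. - (std_normal_density x * R x)) has_real_derivative std_normal_density x * w x) (at x)"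
    if "a \<le> x" for x
    by (rule DERIV_cong[OF DERIV_minus[OF DERIV_mult[OF std_normal_density_has_derivative R[OF that]]]])
      (simp add: algebra_simps)
  from nn_integral_FTC_atLeast[OF _ this _ tendsto_minus[OF lim]] show ?thesis
    by (simp add: w_nonneg)
qed

text \<open>The rational functions in the next two bounds are convergents of Laplace's continued fraction for
  the Mills ratio.\<close>

lemma one_minus_Phi_ge:
  assumes "1 \<le> a"
  shows "std_normal_density a * ((a ^ 3 + 5 * a) / (a ^ 4 + 6 * a\<^sup>2 + 3)) \<le> 1 - Phi a"
proof -
  define D where "D x = x ^ 4 + 6 * x\<^sup>2 + 3" for x :: real
  define R where "R x = (x ^ 3 + 5 * x) / D x" for x
  \<comment> \<open>R misses the equation R' = x R - 1 by exactly 24 / D^2. The sign of this error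
    makes the convergent a lower bound.\<close>
  define w where "w x = 1 - 24 / (D x)\<^sup>2" for x
  have pos: "0 < D x" for x
    unfolding D_def by (simp add: add_nonneg_pos)
  have R: "(R has_real_derivative x * R x - w x) (at x)" for x
  proof (rule DERIV_cong)
    show "(R has_real_derivative ((3 * x\<^sup>2 + 5) * D x - (x ^ 3 + 5 * x) * (4 * x ^ 3 + 12 * x)) / (D x * D x)) (at x)"
      unfolding R_def[abs_def] using pos[of x] unfolding D_def
      by (auto intro!: derivative_eq_intros)
    have "(3 * x\<^sup>2 + 5) * D x - (x ^ 3 + 5 * x) * (4 * x ^ 3 + 12 * x) = x * (x ^ 3 + 5 * x) * D x - (D x * D x - 24)"
      unfolding D_def by algebra
    then show "((3 * x\<^sup>2 + 5) * D x - (x ^ 3 + 5 * x) * (4 * x ^ 3 + 12 * x)) / (D x * D x) = x * R x - w x"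
      using pos[of x] by (simp add: R_def w_def power2_eq_square divide_simps)
  qed
  have lim: "((\<lambda>x. std_normal_density x * R x) \<longlongrightarrow> 0) at_top"
    unfolding R_def D_def std_normal_density_def by real_asymp
  have nonneg: "0 \<le> w x" if "a \<le> x" for x
  proof -
    have "1 \<le> x" using that assms by simp
    then have "1 \<le> x ^ 4" "1 \<le> x\<^sup>2" by (simp_all add: one_le_power)
    then have "10 \<le> D x" unfolding D_def by simp
    then have "24 \<le> (D x)\<^sup>2"
      using power_mono[of 10 "D x" 2] by simp
    then show ?thesis
      using pos[of x] unfolding w_def by (simp add: divide_le_eq_1_pos)
  qed
  have [measurable]: "w \<in> borel_measurable borel"
    unfolding w_def D_def by measurable
  have "ennreal (std_normal_density a * R a)
      = (\<integral>\<^sup>+x. ennreal (std_normal_density x * w x) * indicator {a..} x \<partial>lborel)"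
    using nn_integral_std_normal_tail[OF _ nonneg R lim] by simp
  also have "\<dots> \<le> (\<integral>\<^sup>+x. ennreal (std_normal_density x) * indicator {a..} x \<partial>lborel)"
  proof (intro nn_integral_mono mult_right_mono ennreal_leI)
    show "std_normal_density x * w x \<le> std_normal_density x" for x
      using mult_left_mono[of "w x" 1 "std_normal_density x"] by (simp add: w_def)
  qed simp
  also have "\<dots> = ennreal (1 - Phi a)"
    by (rule one_minus_Phi[symmetric])
  finally have "std_normal_density a * R a \<le> 1 - Phi a"
    by (subst (asm) ennreal_le_iff) (auto simp: Phi_def intro!: prob_space.prob_le_1 prob_space_normal_density)
  then show ?thesis by (simp add: R_def D_def)
qed

lemma one_minus_Phi_le:
  assumes "0 < a"
  shows "1 - Phi a \<le> std_normal_density a * ((a ^ 4 + 9 * a\<^sup>2 + 8) / (a ^ 5 + 10 * a ^ 3 + 15 * a))"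
proof -
  define D where "D x = x ^ 5 + 10 * x ^ 3 + 15 * x" for x :: real
  define R where "R x = (x ^ 4 + 9 * x\<^sup>2 + 8) / D x" for x
  \<comment> \<open>The error 120 / D^2 now has the opposite sign, which gives an upper
    bound.\<close>
  define w where "w x = 1 + 120 / (D x)\<^sup>2" for x
  have pos: "0 < D x" if "a \<le> x" for x
    unfolding D_def using that assms by (simp add: add_pos_pos)
  have R: "(R has_real_derivative x * R x - w x) (at x)" if "a \<le> x" for x
  proof (rule DERIV_cong)
    show "(R has_real_derivative ((4 * x ^ 3 + 18 * x) * D x - (x ^ 4 + 9 * x\<^sup>2 + 8) * (5 * x ^ 4 + 30 * x\<^sup>2 + 15)) / (D x * D x)) (at x)"
      unfolding R_def[abs_def] using pos[OF that] unfolding D_def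
      by (auto intro!: derivative_eq_intros)
    have "(4 * x ^ 3 + 18 * x) * D x - (x ^ 4 + 9 * x\<^sup>2 + 8) * (5 * x ^ 4 + 30 * x\<^sup>2 + 15)
        = x * (x ^ 4 + 9 * x\<^sup>2 + 8) * D x - (D x * D x + 120)"
      unfolding D_def by algebra
    then show "((4 * x ^ 3 + 18 * x) * D x - (x ^ 4 + 9 * x\<^sup>2 + 8) * (5 * x ^ 4 + 30 * x\<^sup>2 + 15)) / (D x * D x) = x * R x - w x"
      using pos[OF that] by (simp add: R_def w_def power2_eq_square divide_simps)
  qed
  have lim: "((\<lambda>x. std_normal_density x * R x) \<longlongrightarrow> 0) at_top"
    unfolding R_def D_def std_normal_density_def by real_asymp
  have [measurable]: "w \<in> borel_measurable borel"
    unfolding w_def D_def by measurable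
  have "ennreal (1 - Phi a) = (\<integral>\<^sup>+x. ennreal (std_normal_density x) * indicator {a..} x \<partial>lborel)"
    by (rule one_minus_Phi)
  also have "\<dots> \<le> (\<integral>\<^sup>+x. ennreal (std_normal_density x * w x) * indicator {a..} x \<partial>lborel)"
  proof (intro nn_integral_mono mult_right_mono ennreal_leI)
    show "std_normal_density x \<le> std_normal_density x * w x" for x
      using mult_left_mono[of 1 "w x" "std_normal_density x"] by (simp add: w_def)
  qed simp
  also have "\<dots> = ennreal (std_normal_density a * R a)"
    by (rule nn_integral_std_normal_tail[OF _ _ R lim]) (simp_all add: w_def[abs_def] D_def)
  finally have "1 - Phi a \<le> std_normal_density a * R a"
    using assms pos[of a] by (subst (asm) ennreal_le_iff) (auto simp: R_def)
  then show ?thesis by (simp add: R_def D_def)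
qed

text \<open>With r the quotient of the tails at 2 and sqrt 2, G(1/4) = 1/2 - r/4, so r \<ge> 28/100
  is needed. The convergents give the factors 18/43 at 2 and 30/(39 sqrt 2) at sqrt 2, and the two
  densities differ by the factor e.\<close>

lemma G_quarter_le: "G (1 / 4) \<le> 43 / 100"
proof -
  have dens: "std_normal_density (sqrt 2) = std_normal_density 2 * exp 1"
    by (simp add: std_normal_density_def flip: exp_add)
  have s: "sqrt 2 ^ 2 = 2" "sqrt 2 ^ 3 = 2 * sqrt 2" "sqrt 2 ^ 4 = 4" "sqrt 2 ^ 5 = 4 * sqrt 2"
    by (simp_all add: eval_nat_numeral)
  have low: "std_normal_density 2 * (18 / 43) \<le> 1 - Phi 2"
    using one_minus_Phi_ge[of 2] by simp
  have "1 - Phi (sqrt 2) \<le> std_normal_density (sqrt 2) * (30 / (39 * sqrt 2))"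
    using one_minus_Phi_le[of "sqrt 2"] unfolding s by simp
  also have "\<dots> = std_normal_density 2 * (exp 1 * (30 / (39 * sqrt 2)))"
    by (simp add: dens)
  also have "\<dots> \<le> std_normal_density 2 * ((272 / 100) * (30 / (39 * (1414 / 1000))))"
  proof -
    have "1414 / 1000 \<le> sqrt 2" by (rule real_le_rsqrt) (simp add: power2_eq_square)
    moreover have "exp (1::real) \<le> 272 / 100" using e_less_272 by simp
    ultimately show ?thesis
      by (intro mult_left_mono mult_mono divide_left_mono) auto
  qed
  also have "\<dots> \<le> (1 / (28 / 100)) * (std_normal_density 2 * (18 / 43))"
    using normal_density_nonneg[of 0 1 2] by simp
  also have "\<dots> \<le> (1 / (28 / 100)) * (1 - Phi 2)"
    using low by simp
  finally have le: "28 / 100 * (1 - Phi (sqrt 2)) \<le> 1 - Phi 2" by simp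
  have "0 < std_normal_density (sqrt 2)"
    by (simp add: normal_density_pos)
  then have "0 < std_normal_density (sqrt 2) * ((sqrt 2 ^ 3 + 5 * sqrt 2) / (sqrt 2 ^ 4 + 6 * (sqrt 2)\<^sup>2 + 3))"
    unfolding s by simp
  also have "\<dots> \<le> 1 - Phi (sqrt 2)"
    by (rule one_minus_Phi_ge) simp
  finally have pos: "0 < 1 - Phi (sqrt 2)" .
  have "(1 / 4 :: real) powr (- 1 / 2) = 2"
    by (simp add: powr_minus powr_half_sqrt real_sqrt_divide)
  moreover define r where "r = (1 - Phi 2) / (1 - Phi (sqrt 2))"
  ultimately have "G (1 / 4) = 1 / 2 * (1 - 1 / 2 * r)"
    by (simp add: G_def)
  moreover have "28 / 100 \<le> r"
    using le pos by (simp add: r_def pos_le_divide_eq)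
  ultimately show ?thesis by simp
qed

section \<open>Conclusion\<close>

theorem theorem1:
  fixes n :: nat and v :: "nat \<Rightarrow> real"
  assumes "n \<ge> 1"
    and "(\<Sum>i=1..n. (v i)\<^sup>2) \<le> 1"
  shows "measure_pmf.prob (rademacher n)
           {\<epsilon>. \<bar>\<Sum>i=1..n. v i * \<epsilon> i\<bar> \<le> 1} \<ge> G (1/4)"
proof -
  let ?vs = "map v [1..<Suc n]"
  \<comment> \<open>Four zeros guarantee four leading weights even for small n and change neither
    the sum nor the variance. Sorting by \<open>uminus\<close> gives decreasing order.\<close>
  define ws where "ws = sort_key uminus (0 # 0 # 0 # 0 # map abs ?vs)"
  have "sign_mean unit_ind 0 ws = sign_mean unit_ind 0 (0 # 0 # 0 # 0 # map abs ?vs)"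
    unfolding ws_def by (rule sign_mean_sort)
  also have "\<dots> = sign_mean unit_ind 0 (map abs ?vs)"
    by (simp only: sign_mean.simps) simp
  finally have mean: "sign_mean unit_ind 0 ws = sign_mean unit_ind 0 ?vs"
    by (simp only: sign_mean_abs)
  have "sum_sq ws = sum_mset (image_mset power2 (mset ws))"
    by (metis mset_map sum_mset_sum_list)
  also have "mset ws = mset (0 # 0 # 0 # 0 # map abs ?vs)"
    unfolding ws_def by simp
  also have "sum_mset (image_mset power2 \<dots>) = sum_sq (0 # 0 # 0 # 0 # map abs ?vs)"
    by (metis mset_map sum_mset_sum_list)
  also have "\<dots> = (\<Sum>i\<leftarrow>[1..<Suc n]. (v i)\<^sup>2)"
    by (simp add: o_def del: upt_Suc)
  also have "\<dots> = (\<Sum>i=1..n. (v i)\<^sup>2)"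
    by (simp add: sum_list_distinct_conv_sum_set atLeastLessThanSuc_atLeastAtMost del: upt_Suc)
  finally have sum: "sum_sq ws \<le> 1" using assms(2) by simp
  have "4 \<le> length ws" unfolding ws_def by simp
  then obtain a b c d vs where ws: "ws = a # b # c # d # vs"
    by (auto simp: numeral_eq_Suc Suc_le_length_iff)
  have "sorted (map uminus ws)" unfolding ws_def by (rule sorted_sort_key)
  moreover have "0 \<le> x" if "x \<in> set ws" for x
    using that unfolding ws_def set_sort by auto
  ultimately have "43 / 100 \<le> sign_mean unit_ind 0 ws"
    using sum unfolding ws by (intro sign_mean_ge_43_of_sorted) auto
  then show ?thesis
    unfolding prob_rademacher_eq_sign_mean using G_quarter_le mean by simp
qed

end
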